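(* For every pair of integers $r, k \ge 3$, there exists $C = C(r,k) > 0$ such that for all $n \in \mathbb{N}$, the number of $C^r_k$-free $r$-uniform hypergraphs on the vertex set $[n]=\{1,\dots,n\}$ is at most $2^{C n^{r-1}}$; that is, $|\mathrm{Forb}_r(n, C^r_k)| \le 2^{C n^{r-1}}$.
   Context: An $r$-uniform hypergraph ($r$-graph) is a pair $(V,E)$ of finite sets with $E$ a family of $r$-element subsets of $V$. For integers $r \ge 2$ and $k \ge 3$, the $r$-uniform linear $k$-cycle $C^r_k$ is the $r$-graph on $k(r-1)$ vertices whose vertices can be ordered cyclically so that its edges (exactly $k$ of them) are sets of $r$ consecutive vertices in this ordering and every two consecutive edges share exactly one vertex. $\mathrm{Forb}_r(n,H)$ denotes the family of all $r$-graphs on vertex set $[n]$ containing no copy of $H$ as a subgraph (i.e., $H$-free). *)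

theory Defs
  imports Complex_Main
begin

type_synonym 'a hypergraph = "'a set \<times> 'a set set"

definition uniform_hypergraph :: "nat \<Rightarrow> 'a hypergraph \<Rightarrow> bool" where
  "uniform_hypergraph r G \<longleftrightarrow>
     finite (fst G) \<and> (\<forall>e\<in>snd G. e \<subseteq> fst G \<and> card e = r)"

definition subhypergraph :: "'a hypergraph \<Rightarrow> 'a hypergraph \<Rightarrow> bool" where
  "subhypergraph H G \<longleftrightarrow> fst H \<subseteq> fst G \<and> snd H \<subseteq> snd G"

definition contains_copy :: "'a hypergraph \<Rightarrow> 'b hypergraph \<Rightarrow> bool" where
  "contains_copy G H \<longleftrightarrow>
     (\<exists>f. inj_on f (fst H) \<and> subhypergraph (f ` fst H, (\<lambda>e. f ` e) ` snd H) G)"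

definition Forb :: "nat \<Rightarrow> nat \<Rightarrow> 'b hypergraph \<Rightarrow> nat hypergraph set" where
  "Forb r n H = {G. uniform_hypergraph r G \<and> fst G = {1..n} \<and> \<not> contains_copy G H}"

text \<open>The vertices \<open>0, \<dots>, k (r - 1) - 1\<close> are in their natural cyclic order. Two
  consecutive edges share exactly one vertex, so the first vertices of consecutive edges are
  \<open>r - 1\<close> apart.\<close>

definition linear_cycle_edge :: "nat \<Rightarrow> nat \<Rightarrow> nat \<Rightarrow> nat set" where
  "linear_cycle_edge r k i = (\<lambda>j. (i * (r - 1) + j) mod (k * (r - 1))) ` {..<r}"

definition linear_cycle :: "nat \<Rightarrow> nat \<Rightarrow> nat hypergraph" where
  "linear_cycle r k = ({..<k * (r - 1)}, linear_cycle_edge r k ` {..<k})"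

lemma finite_Forb: "finite (Forb r n H)"
proof (rule finite_subset)
  show "Forb r n H \<subseteq> {{1..n}} \<times> Pow (Pow {1..n})"
    by (fastforce simp: Forb_def uniform_hypergraph_def)
qed auto

lemma linear_cycle_edge_eq:
  assumes "2 \<le> r" "3 \<le> k" "i < k"
  shows "linear_cycle_edge r k i =
    insert ((Suc i mod k) * (r - 1)) {i * (r - 1)..<Suc i * (r - 1)}"
proof -
  define m where "m = r - 1"
  have r: "{..<r} = insert m {..<m}"
    using assms(1) by (auto simp: m_def)
  have le: "Suc i * m \<le> k * m"
    using assms(3) by (intro mult_le_mono1) simp
  have 1: "(\<lambda>j. (i * m + j) mod (k * m)) ` {..<m} = (\<lambda>j. i * m + j) ` {..<m}"
    using le by (intro image_cong refl mod_less) auto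
  have 2: "(\<lambda>j. i * m + j) ` {..<m} = {i * m..<Suc i * m}"
    by (auto simp: lessThan_atLeast0 add.commute)
  have 3: "(i * m + m) mod (k * m) = (Suc i mod k) * m"
    by (metis add.commute mult_Suc mod_mult_mult2)
  show ?thesis
    unfolding linear_cycle_edge_def m_def[symmetric] r image_insert 1 2 3 ..
qed

lemma div_linear_cycle_block:
  assumes "0 < m"
  shows "x \<in> {i * m..<Suc i * m} \<longleftrightarrow> x div m = i"
  using assms dividend_less_div_times[OF assms, of x]
  by (auto simp: div_nat_eqI add.commute mult.commute)

lemma consecutive_linear_cycle_edges:
  assumes "2 \<le> r" "3 \<le> k" "i < k"
  shows "linear_cycle_edge r k i \<inter> linear_cycle_edge r k (Suc i mod k) =
    {(Suc i mod k) * (r - 1)}"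
proof -
  have m: "0 < r - 1" using assms by simp
  have ne: "Suc i mod k \<noteq> i" "Suc (Suc i mod k) mod k \<noteq> i"
       "Suc (Suc i mod k) mod k \<noteq> Suc i mod k"
    using assms by (auto simp: mod_Suc)
  have mem: "x \<in> linear_cycle_edge r k j \<longleftrightarrow> x = (Suc j mod k) * (r - 1) \<or> x div (r - 1) = j"
    if "j < k" for x j
    using linear_cycle_edge_eq[OF assms(1,2) that] div_linear_cycle_block[OF m] by auto
  have "Suc i mod k < k" using assms by simp
  have "x \<in> linear_cycle_edge r k i \<inter> linear_cycle_edge r k (Suc i mod k) \<longleftrightarrow>
      x = (Suc i mod k) * (r - 1)" for x
  proof -
    have "x div (r - 1) = a" if "x = a * (r - 1)" for a
      using that m by simp
    then show ?thesis
      using ne unfolding Int_iff mem[OF \<open>i < k\<close>] mem[OF \<open>Suc i mod k < k\<close>] by metis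
  qed
  then show ?thesis by blast
qed

lemma card_linear_cycle_edge:
  assumes "2 \<le> r" "3 \<le> k" "i < k"
  shows "card (linear_cycle_edge r k i) = r"
proof -
  have m: "0 < r - 1" using assms by simp
  have "Suc i mod k \<noteq> i" using assms by (auto simp: mod_Suc)
  then have "(Suc i mod k) * (r - 1) \<notin> {i * (r - 1)..<Suc i * (r - 1)}"
    unfolding div_linear_cycle_block[OF m] using m by simp
  then show ?thesis
    unfolding linear_cycle_edge_eq[OF assms] using assms(1) by simp
qed

lemma card_linear_cycle:
  assumes "2 \<le> r" "3 \<le> k"
  shows "card (fst (linear_cycle r k)) = k * (r - 1)" "card (snd (linear_cycle r k)) = k"
proof -
  have m: "0 < r - 1" using assms by simp
  have "inj_on (linear_cycle_edge r k) {..<k}"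
  proof (rule inj_onI)
    fix i j assume ij: "i \<in> {..<k}" "j \<in> {..<k}"
      and eq: "linear_cycle_edge r k i = linear_cycle_edge r k j"
    have mem: "x \<in> linear_cycle_edge r k j \<longleftrightarrow> x = (Suc j mod k) * (r - 1) \<or> x div (r - 1) = j"
      if "j < k" for x j
      using linear_cycle_edge_eq[OF assms that] div_linear_cycle_block[OF m] by auto
    have "i * (r - 1) \<in> linear_cycle_edge r k j" "j * (r - 1) \<in> linear_cycle_edge r k i"
      using mem[of i "i * (r - 1)"] mem[of j "j * (r - 1)"] eq ij m by auto
    then have "(i = Suc j mod k \<or> i = j) \<and> (j = Suc i mod k \<or> i = j)"
      using mem[of j "i * (r - 1)"] mem[of i "j * (r - 1)"] ij m by auto
    then show "i = j"
      using ij assms(2) by (auto simp: mod_Suc split: if_splits)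
  qed
  then show "card (snd (linear_cycle r k)) = k"
    by (simp add: linear_cycle_def card_image)
qed (simp add: linear_cycle_def)

lemma uniform_linear_cycle:
  assumes "2 \<le> r" "3 \<le> k"
  shows "uniform_hypergraph r (linear_cycle r k)"
  using assms card_linear_cycle_edge[OF assms]
  by (auto simp: uniform_hypergraph_def linear_cycle_def linear_cycle_edge_def)

end

theory Submission
  imports Defs "HOL-Library.FuncSet"
begin

text \<open>
  The proof combines a container lemma with a balanced supersaturation result. Given an \<open>r\<close>-graph
  with \<open>t n\<^sup>r\<^sup>-\<^sup>1\<close> edges, pass to a subgraph \<open>G\<close> with at least half of the edges in which every
  \<open>(r - 1)\<close>-subset of an edge lies in at least \<open>D = t / 2\<close> edges. The move that replaces one chosen
  vertex of an edge by a uniformly random alternative is reversible with respect to the uniform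
  measure on edges. Running it along a tree-shaped pattern that contains a linear \<open>k\<close>-cycle
  therefore yields a random cycle each of whose edges is uniform in \<open>G\<close>, and fixing \<open>j\<close> of its
  edges costs a factor of at most \<open>D\<close> to the power \<open>-3 (j - 1) / 2\<close> beyond the first: this is where
  \<open>r \<ge> 3\<close> enters. Containers with \<open>p = D\<close> to the power \<open>-3 / 2\<close> then cover all cycle-free subgraphs
  of \<open>G\<close> by \<open>exp (O (n\<^sup>r\<^sup>-\<^sup>1 t\<^sup>-\<^sup>1\<^sup>/\<^sup>4))\<close> sets, each smaller by a constant factor. Iterating, the
  exponents form a geometric series with sum \<open>O (n\<^sup>r\<^sup>-\<^sup>1)\<close>.
\<close>

section \<open>Hypergraph containers for weighted hypergraphs\<close>

text \<open>Codegrees in the full subgraph are bounded below by \<open>D\<close> but not above, so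
  cycles built greedily could favour some edges; weighting each choice by the reciprocal of its
  codegree removes this bias. A cycle closes up, so its vertices cannot all be chosen freely one at
  a time; the pattern therefore has extra vertices and edges that carry the cycle. The exponent
  \<open>3 / 2\<close> is forced by \<open>r = k = 3\<close>: the three edges span 6 vertices, so
  the two edges beyond the first gain three factors \<open>1 / D\<close>. What matters is that it
  exceeds 1. One container step costs about \<open>p * card G * ln D\<close> in the exponent; with
  \<open>card G\<close> of order \<open>D * n ^ (r - 1)\<close> this is \<open>n ^ (r - 1)\<close>
  times \<open>D powr (- 1 / 2) * ln D\<close>, and half of the decay pays for the logarithm. With
  \<open>p = 1 / D\<close>, the most that \<open>r = 2\<close> could give, each step would cost at
  least order \<open>n ^ (r - 1)\<close>, and the number of steps grows with \<open>n\<close>. In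
  the container section \<open>V\<close> is to be read as the edge set of \<open>G\<close>, and the
  sets weighted by \<open>w\<close> as its linear cycles.\<close>

definition wdeg :: "'a set \<Rightarrow> ('a set \<Rightarrow> real) \<Rightarrow> 'a set \<Rightarrow> real" where
  "wdeg V w A = (\<Sum>e | e \<subseteq> V \<and> A \<subseteq> e. w e)"

definition windep :: "'a set \<Rightarrow> ('a set \<Rightarrow> real) \<Rightarrow> 'a set \<Rightarrow> bool" where
  "windep V w I \<longleftrightarrow> (\<forall>e\<subseteq>V. 0 < w e \<longrightarrow> \<not> e \<subseteq> I)"

lemma wdeg_indicator:
  assumes "finite V"
  shows "wdeg V w A = (\<Sum>e\<in>Pow V. if A \<subseteq> e then w e else 0)"
  using assms unfolding wdeg_def by (subst sum.inter_filter[symmetric]) (auto intro: sum.cong)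

text \<open>Double counting: a set in the support of \<open>u\<close> has \<open>s\<close> elements,
  hence contains at most \<open>2 ^ s\<close> members of \<open>\<A>\<close>.\<close>

lemma sum_wdeg_le:
  assumes "finite V" "\<And>e. 0 \<le> u e" "\<And>e. u e \<noteq> 0 \<Longrightarrow> card e = s" "\<A> \<subseteq> Pow V"
  shows "(\<Sum>A\<in>\<A>. wdeg V u A) \<le> 2 ^ s * wdeg V u {}"
proof -
  have fin: "finite (Pow V)" "finite \<A>"
    using assms(1,4) finite_subset by auto
  have "(\<Sum>A\<in>\<A>. wdeg V u A) = (\<Sum>e\<in>Pow V. \<Sum>A\<in>\<A>. if A \<subseteq> e then u e else 0)"
    unfolding wdeg_indicator[OF assms(1)] by (rule sum.swap)
  also have "\<dots> \<le> (\<Sum>e\<in>Pow V. 2 ^ s * u e)"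
  proof (rule sum_mono)
    fix e assume e: "e \<in> Pow V"
    show "(\<Sum>A\<in>\<A>. if A \<subseteq> e then u e else 0) \<le> 2 ^ s * u e"
    proof (cases "u e = 0")
      case False
      have "finite e" using e assms(1) finite_subset by auto
      have "(\<Sum>A\<in>\<A>. if A \<subseteq> e then u e else 0) = (\<Sum>A\<in>{A\<in>\<A>. A \<subseteq> e}. u e)"
        using fin by (intro sum.inter_filter[symmetric])
      also have "\<dots> \<le> (\<Sum>A\<in>Pow e. u e)"
        using \<open>finite e\<close> assms(2) by (intro sum_mono2) auto
      also have "\<dots> = 2 ^ s * u e"
        using False assms(3) \<open>finite e\<close> by (simp add: card_Pow)
      finally show ?thesis .
    qed (simp cong: if_cong)
  qed
  also have "\<dots> = 2 ^ s * wdeg V u {}"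
    unfolding wdeg_indicator[OF assms(1)] by (simp add: sum_distrib_left)
  finally show ?thesis .
qed

text \<open>
  One level of the container algorithm, as a decision tree that queries vertices \<open>v \<in> U\<close>. A positive
  answer adds the link of \<open>v\<close> to the \<open>s\<close>-uniform weight \<open>u\<close>, except on sets containing some \<open>A\<close> whose
  \<open>u\<close>-degree is already close to the allowed maximum. After \<open>q\<close> positive answers (collected in \<open>T\<close>),
  \<open>u\<close> is heavy enough to continue with uniformity \<open>s\<close>; if no vertex has a heavy link before that,
  then \<open>U \<union> T\<close> is already a small container. Since \<open>p\<^sup>-\<^sup>m + p\<^sup>-\<^sup>m\<^sup>+\<^sup>1 = (1 + p) p\<^sup>-\<^sup>m\<close>, the bound on the
  number of leaves is reproduced exactly by each query.
\<close>

lemma container_branch: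
  fixes V :: "'a set" and w :: "'a set \<Rightarrow> real" and p K K' \<delta> B :: real and s q :: nat
  defines "N \<equiv> real (card V)"
  assumes V: "finite V" "V \<noteq> {}"
    and w0: "\<And>e. 0 \<le> w e" and wcard: "\<And>e. w e \<noteq> 0 \<Longrightarrow> card e = Suc s"
    and wtot: "1 \<le> wdeg V w {}"
    and wdeg: "\<And>A. A \<noteq> {} \<Longrightarrow> p * N * wdeg V w A \<le> K * p ^ card A"
    and p: "0 < p" "8 * K * p \<le> 1" "p \<le> 1" and K: "0 < K"
    and q: "real q \<le> 2 * (p * N)" "p * N \<le> real q"
    and K': "K' = K + 2 ^ (s + 3) * K\<^sup>2"
    and \<delta>: "4 * K * \<delta> \<le> 1" and B: "1 \<le> B"
    and nxt: "\<And>u. (\<And>e. 0 \<le> u e) \<Longrightarrow> (\<And>e. u e \<noteq> 0 \<Longrightarrow> card e = s) \<Longrightarrow> 1 \<le> wdeg V u {} \<Longrightarrow>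
        (\<And>A. A \<noteq> {} \<Longrightarrow> p * N * wdeg V u A \<le> 4 * K' * p ^ card A) \<Longrightarrow>
        \<exists>\<C>. finite \<C> \<and> real (card \<C>) \<le> B \<and> (\<forall>C\<in>\<C>. C \<subseteq> V \<and> real (card C) \<le> (1 - \<delta>) * N) \<and>
            (\<forall>I\<subseteq>V. windep V u I \<longrightarrow> (\<exists>C\<in>\<C>. I \<subseteq> C))"
  shows "\<lbrakk>U \<subseteq> V; T \<subseteq> V - U; card T = m; m \<le> q; \<And>e. 0 \<le> u e; \<And>e. u e \<noteq> 0 \<Longrightarrow> card e = s;
     \<And>A. A \<noteq> {} \<Longrightarrow> N * wdeg V u A \<le> K' * p ^ card A;
     real m \<le> 4 * N * wdeg V u {}; N * wdeg V u {} \<le> real m * K\<rbrakk> \<Longrightarrow>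
     \<exists>\<C>. finite \<C> \<and> real (card \<C>) \<le> (1 + p) ^ card U * (1 / p) ^ (q - m) * B \<and>
       (\<forall>C\<in>\<C>. C \<subseteq> V \<and> real (card C) \<le> (1 - \<delta>) * N) \<and>
       (\<forall>I\<subseteq>V. windep V w I \<longrightarrow> windep V u I \<longrightarrow> I \<inter> (V - U) = T \<longrightarrow> (\<exists>C\<in>\<C>. I \<subseteq> C))"
proof (induction "card U" arbitrary: U T m u rule: less_induct)
  case less
  note U = less.prems(1) and T = less.prems(2,3) and mq = less.prems(4) and u0 = less.prems(5)
    and ucard = less.prems(6) and udeg = less.prems(7) and utot = less.prems(8,9)
  have N: "0 < N" using V by (auto simp: N_def card_gt_0_iff)
  have finU: "finite U" using U V finite_subset by auto
  have K'K: "K < K'" using K K' by simp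
  show ?case
  proof (cases "m = q")
    case True
    \<comment> \<open>Renormalisation: \<open>m = q\<close> and \<open>p * N \<le> q\<close> give
      total weight at least \<open>p / 4\<close>. The factor \<open>4 / p\<close> lifts it to 1 and
      turns the degree constant \<open>K'\<close> into \<open>4 * K'\<close>.\<close>
    define u' where "u' e = u e * (4 / p)" for e
    have deg': "wdeg V u' A = wdeg V u A * (4 / p)" for A
      unfolding wdeg_def u'_def by (rule sum_distrib_right[symmetric])
    have "p \<le> wdeg V u {} * 4"
    proof -
      have "p * N \<le> (wdeg V u {} * 4) * N" using q(2) utot(1) True by (simp add: algebra_simps)
      then show ?thesis using N by simp
    qed
    then have "1 \<le> wdeg V u' {}" using p by (simp add: deg' field_simps)
    moreover have "p * N * wdeg V u' A \<le> 4 * K' * p ^ card A" if "A \<noteq> {}" for A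
      using udeg[OF that] p by (simp add: deg' field_simps)
    moreover have "0 \<le> u' e" "u' e \<noteq> 0 \<Longrightarrow> card e = s" for e
      using u0 p ucard by (auto simp: u'_def)
    ultimately obtain \<C> where \<C>: "finite \<C>" "real (card \<C>) \<le> B"
      "\<forall>C\<in>\<C>. C \<subseteq> V \<and> real (card C) \<le> (1 - \<delta>) * N" "\<forall>I\<subseteq>V. windep V u' I \<longrightarrow> (\<exists>C\<in>\<C>. I \<subseteq> C)"
      using nxt[of u'] by blast
    have "windep V u' I" if "windep V u I" for I
      using that p unfolding windep_def u'_def by (auto simp: zero_less_divide_iff zero_less_mult_iff)
    moreover have "real (card \<C>) \<le> (1 + p) ^ card U * (1 / p) ^ (q - m) * B"
    proof -
      have "1 * B \<le> (1 + p) ^ card U * B" using p B by (intro mult_right_mono one_le_power) auto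
      then show ?thesis using \<C>(2) True by simp
    qed
    ultimately show ?thesis using \<C>(1,3,4) by (intro exI[of _ \<C>]) simp
  next
    case False
    then have mq: "m < q" using mq by simp
    \<comment> \<open>The slack \<open>K\<close> in \<open>K' - K\<close> is what a single link can
      add to the degree of \<open>A\<close>, so a set that is not yet saturated survives one more
      positive answer.\<close>
    define good where "good e \<longleftrightarrow> (\<forall>A\<subseteq>e. A \<noteq> {} \<longrightarrow> N * wdeg V u A \<le> (K' - K) * p ^ card A)" for e
    define link where "link v e = (if e \<subseteq> U \<and> v \<notin> e \<and> good e then w (insert v e) else 0)" for v e
    have link0: "0 \<le> link v e" for v e using w0 by (simp add: link_def)
    have linkcard: "card e = s" if "link v e \<noteq> 0" for v e
    proof -
      have "e \<subseteq> U" "v \<notin> e" "w (insert v e) \<noteq> 0" using that by (auto simp: link_def split: if_splits)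
      then show ?thesis using wcard[of "insert v e"] finite_subset[OF \<open>e \<subseteq> U\<close> finU] by simp
    qed
    \<comment> \<open>Query a vertex as long as one has a link of weight at least
      \<open>1 / (4 * N)\<close>; this is the gain per positive answer recorded in the lower bound
      on \<open>wdeg V u {}\<close>.\<close>
    show ?thesis
    proof (cases "\<exists>v\<in>U. 1 \<le> 4 * N * wdeg V (link v) {}")
      case True
      then obtain v where v: "v \<in> U" "1 \<le> 4 * N * wdeg V (link v) {}" by blast
      have vV: "v \<in> V" using v U by auto
      have cU: "card U = Suc (card (U - {v}))" by (rule card.remove[OF finU v(1)])
      \<comment> \<open>A set in the link containing \<open>A\<close> comes from a set of
        \<open>w\<close> containing \<open>insert v A\<close>, whose degree bound has one more
        factor \<open>p\<close>.\<close>
      have linkdeg: "p * N * wdeg V (link v) A \<le> K * p ^ Suc (card A)" for A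
      proof (cases "A \<subseteq> V \<and> v \<notin> A")
        case True
        have "wdeg V (link v) A \<le> (\<Sum>e | e \<subseteq> V \<and> A \<subseteq> e \<and> v \<notin> e. w (insert v e))"
          unfolding wdeg_def using V(1) w0
          by (subst sum.mono_neutral_right[of "{e. e \<subseteq> V \<and> A \<subseteq> e}" "{e. e \<subseteq> V \<and> A \<subseteq> e \<and> v \<notin> e}"])
             (auto simp: link_def intro!: sum_mono)
        also have "\<dots> = (\<Sum>e\<in>insert v ` {e. e \<subseteq> V \<and> A \<subseteq> e \<and> v \<notin> e}. w e)"
          by (subst sum.reindex) (auto simp: inj_on_def)
        also have "\<dots> \<le> wdeg V w (insert v A)"
          unfolding wdeg_def using V(1) w0 vV by (intro sum_mono2) auto
        finally have "p * N * wdeg V (link v) A \<le> p * N * wdeg V w (insert v A)"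
          using p N by (simp add: mult_left_mono)
        also have "\<dots> \<le> K * p ^ card (insert v A)" by (rule wdeg) simp
        also have "card (insert v A) = Suc (card A)"
          using True finite_subset[of A V] V(1) by simp
        finally show ?thesis .
      next
        case False
        then have "wdeg V (link v) A = 0" unfolding wdeg_def
          by (intro sum.neutral) (auto simp: link_def)
        then show ?thesis using p K by simp
      qed
      define u' where "u' e = u e + link v e" for e
      have deg': "wdeg V u' A = wdeg V u A + wdeg V (link v) A" for A
        unfolding wdeg_def u'_def by (simp add: sum.distrib)
      have linkdeg': "N * wdeg V (link v) A \<le> K * p ^ card A" for A
        using linkdeg[of A] p by (simp add: algebra_simps)
      have udeg': "N * wdeg V u' A \<le> K' * p ^ card A" if A: "A \<noteq> {}" for A
      proof (cases "N * wdeg V u A \<le> (K' - K) * p ^ card A")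
        case True
        then show ?thesis using linkdeg'[of A] by (simp add: deg' algebra_simps)
      next
        case False
        then have "link v e = 0" if "A \<subseteq> e" for e
          using that A unfolding link_def good_def by metis
        then have "wdeg V (link v) A = 0" by (simp add: wdeg_def)
        then show ?thesis using udeg[OF A] by (simp add: deg')
      qed
      \<comment> \<open>Answer no (\<open>v\<close> outside \<open>I\<close>): only \<open>U\<close>
        shrinks, \<open>T\<close> and \<open>u\<close> stay.\<close>
      have IH1: "\<exists>\<C>. finite \<C> \<and> real (card \<C>) \<le> (1 + p) ^ card (U - {v}) * (1 / p) ^ (q - m) * B \<and>
       (\<forall>C\<in>\<C>. C \<subseteq> V \<and> real (card C) \<le> (1 - \<delta>) * N) \<and>
       (\<forall>I\<subseteq>V. windep V w I \<longrightarrow> windep V u I \<longrightarrow> I \<inter> (V - (U - {v})) = T \<longrightarrow> (\<exists>C\<in>\<C>. I \<subseteq> C))"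
      proof (rule less.hyps)
        show "card (U - {v}) < card U" using cU by simp
        show "U - {v} \<subseteq> V" "T \<subseteq> V - (U - {v})" using U T by auto
        show "card T = m" "m \<le> q" using T mq by auto
      qed (fact u0 ucard udeg utot)+
      have finT: "finite T" using T V finite_subset by blast
      have "v \<notin> T" using v T by auto
      then have cT: "card (insert v T) = Suc m" using T finT by simp
      \<comment> \<open>Answer yes (\<open>v\<close> in \<open>I\<close>): then \<open>I\<close> is
        also independent for the link of \<open>v\<close>, which is merged into
        \<open>u\<close>.\<close>
      have IH2: "\<exists>\<C>. finite \<C> \<and> real (card \<C>) \<le> (1 + p) ^ card (U - {v}) * (1 / p) ^ (q - Suc m) * B \<and>
       (\<forall>C\<in>\<C>. C \<subseteq> V \<and> real (card C) \<le> (1 - \<delta>) * N) \<and>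
       (\<forall>I\<subseteq>V. windep V w I \<longrightarrow> windep V u' I \<longrightarrow> I \<inter> (V - (U - {v})) = insert v T \<longrightarrow> (\<exists>C\<in>\<C>. I \<subseteq> C))"
      proof (rule less.hyps)
        show "0 \<le> u' e" for e using u0 link0 by (simp add: u'_def)
        show "card e = s" if "u' e \<noteq> 0" for e
          using that ucard[of e] linkcard[of v e] unfolding u'_def by linarith
        show "real (Suc m) \<le> 4 * N * wdeg V u' {}"
          using utot(1) v(2) by (simp add: deg' algebra_simps)
        show "N * wdeg V u' {} \<le> real (Suc m) * K"
          using utot(2) linkdeg'[of "{}"] by (simp add: deg' algebra_simps)
        show "card (U - {v}) < card U" using cU by simp
        show "U - {v} \<subseteq> V" "insert v T \<subseteq> V - (U - {v})" using U T vV by auto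
        show "Suc m \<le> q" using mq by simp
      qed (fact cT udeg')+
      obtain \<C>1 where \<C>1: "finite \<C>1" "real (card \<C>1) \<le> (1 + p) ^ card (U - {v}) * (1 / p) ^ (q - m) * B"
       "\<forall>C\<in>\<C>1. C \<subseteq> V \<and> real (card C) \<le> (1 - \<delta>) * N"
       "\<forall>I\<subseteq>V. windep V w I \<longrightarrow> windep V u I \<longrightarrow> I \<inter> (V - (U - {v})) = T \<longrightarrow> (\<exists>C\<in>\<C>1. I \<subseteq> C)"
        using IH1 by blast
      obtain \<C>2 where \<C>2: "finite \<C>2" "real (card \<C>2) \<le> (1 + p) ^ card (U - {v}) * (1 / p) ^ (q - Suc m) * B"
       "\<forall>C\<in>\<C>2. C \<subseteq> V \<and> real (card C) \<le> (1 - \<delta>) * N"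
       "\<forall>I\<subseteq>V. windep V w I \<longrightarrow> windep V u' I \<longrightarrow> I \<inter> (V - (U - {v})) = insert v T \<longrightarrow> (\<exists>C\<in>\<C>2. I \<subseteq> C)"
        using IH2 by blast
      show ?thesis
      proof (intro exI[of _ "\<C>1 \<union> \<C>2"] conjI allI impI)
        show "finite (\<C>1 \<union> \<C>2)" using \<C>1 \<C>2 by simp
        have "real (card (\<C>1 \<union> \<C>2)) \<le> real (card \<C>1) + real (card \<C>2)"
          using card_Un_le[of \<C>1 \<C>2] by linarith
        also have "\<dots> \<le> (1 + p) ^ card (U - {v}) * B * ((1 / p) ^ (q - m) + (1 / p) ^ (q - Suc m))"
          using \<C>1(2) \<C>2(2) by (simp add: algebra_simps)
        also have "(1 / p) ^ (q - m) + (1 / p) ^ (q - Suc m) = (1 + p) * (1 / p) ^ (q - m)"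
        proof -
          have "q - m = Suc (q - Suc m)" using mq by simp
          then show ?thesis using p by (simp add: field_simps)
        qed
        finally show "real (card (\<C>1 \<union> \<C>2)) \<le> (1 + p) ^ card U * (1 / p) ^ (q - m) * B"
          by (simp add: cU algebra_simps)
        show "\<forall>C\<in>\<C>1 \<union> \<C>2. C \<subseteq> V \<and> real (card C) \<le> (1 - \<delta>) * N" using \<C>1 \<C>2 by blast
        fix I assume I: "I \<subseteq> V" "windep V w I" "windep V u I" "I \<inter> (V - U) = T"
        show "\<exists>C\<in>\<C>1 \<union> \<C>2. I \<subseteq> C"
        proof (cases "v \<in> I")
          case False
          then have "I \<inter> (V - (U - {v})) = T" using I by auto
          then show ?thesis using \<C>1(4) I by blast
        next
          case True
          then have "I \<inter> (V - (U - {v})) = insert v T" using I vV by auto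
          moreover have "windep V u' I"
            unfolding windep_def
          proof (intro allI impI notI)
            fix e assume e: "e \<subseteq> V" "0 < u' e" "e \<subseteq> I"
            then have "\<not> 0 < u e" using I(3) by (auto simp: windep_def)
            then have "0 < link v e" using e by (simp add: u'_def)
            then have "0 < w (insert v e)" by (auto simp: link_def split: if_splits)
            moreover have "insert v e \<subseteq> V" "insert v e \<subseteq> I" using e vV True by auto
            ultimately show False using I(2) unfolding windep_def by blast
          qed
          ultimately show ?thesis using \<C>2(4) I by blast
        qed
      qed
    next
      case False
      \<comment> \<open>No link is heavy any more. Each weighted set meets \<open>V - U\<close>, or
        is counted in the link of one of its vertices, or contains a saturated \<open>A\<close>. The
        last two kinds carry total weight at most \<open>1 / 4\<close> each, so weight at least
        \<open>1 / 2\<close> meets \<open>V - U\<close>; as a vertex has degree at most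
        \<open>K / N\<close>, the set \<open>V - U\<close> has at least \<open>N / (2 * K)\<close>
        elements.\<close>
      define Sat where "Sat = {A. A \<subseteq> V \<and> A \<noteq> {} \<and> (K' - K) * p ^ card A < N * wdeg V u A}"
      have fin: "finite Sat" "finite (Pow V)" "finite (V - U)" using V by (auto simp: Sat_def)
      have key: "w e \<le> (\<Sum>x\<in>V - U. if {x} \<subseteq> e then w e else 0)
          + (\<Sum>v\<in>U. if v \<in> e then link v (e - {v}) else 0)
          + (\<Sum>A\<in>Sat. if A \<subseteq> e then w e else 0)" (is "_ \<le> ?a + ?b + ?c") if e: "e \<in> Pow V" for e
      proof (cases "w e = 0")
        case True
        then show ?thesis using link0 by (simp add: sum_nonneg cong: if_cong)
      next
        case False
        have nn: "0 \<le> ?a" "0 \<le> ?b" "0 \<le> ?c" using link0 w0 by (auto intro!: sum_nonneg)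
        have "e \<noteq> {}" using wcard[OF False] by auto
        then obtain v where v: "v \<in> e" by blast
        consider x where "x \<in> V - U" "x \<in> e" | "e \<subseteq> U" "good (e - {v})" | "e \<subseteq> U" "\<not> good (e - {v})"
          using e by blast
        then show ?thesis
        proof cases
          case 1
          have "w e \<le> ?a"
            using member_le_sum[of x "V - U" "\<lambda>x. if {x} \<subseteq> e then w e else 0"] 1 fin w0 by simp
          then show ?thesis using nn by linarith
        next
          case 2
          have "w e = link v (e - {v})" using 2 v by (simp add: link_def insert_absorb subset_iff)
          moreover have "v \<in> U" using 2 v by blast
          ultimately have "w e \<le> ?b"
            using member_le_sum[of v U "\<lambda>v. if v \<in> e then link v (e - {v}) else 0"] v finU link0
            by simp
          then show ?thesis using nn by linarith
        next
          case 3
          then obtain A where A: "A \<subseteq> e - {v}" "A \<noteq> {}" "(K' - K) * p ^ card A < N * wdeg V u A"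
            unfolding good_def by (metis not_le)
          then have "A \<subseteq> V" "A \<subseteq> e" using e by auto
          then have "A \<in> Sat" using A by (simp add: Sat_def)
          then have "w e \<le> ?c"
            using member_le_sum[of A Sat "\<lambda>A. if A \<subseteq> e then w e else 0"] fin w0 \<open>A \<subseteq> e\<close> by simp
          then show ?thesis using nn by linarith
        qed
      qed
      have "1 \<le> (\<Sum>e\<in>Pow V. w e)" using wtot by (simp add: wdeg_indicator[OF V(1)])
      also have "\<dots> \<le> (\<Sum>e\<in>Pow V. \<Sum>x\<in>V - U. if {x} \<subseteq> e then w e else 0)
          + (\<Sum>e\<in>Pow V. \<Sum>v\<in>U. if v \<in> e then link v (e - {v}) else 0)
          + (\<Sum>e\<in>Pow V. \<Sum>A\<in>Sat. if A \<subseteq> e then w e else 0)"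
        unfolding sum.distrib[symmetric] by (intro sum_mono key)
      also have "\<dots> = (\<Sum>x\<in>V - U. wdeg V w {x})
          + (\<Sum>v\<in>U. \<Sum>e\<in>Pow V. if v \<in> e then link v (e - {v}) else 0)
          + (\<Sum>A\<in>Sat. wdeg V w A)"
        unfolding wdeg_indicator[OF V(1)]
        by (intro arg_cong2[where f = "(+)"] sum.swap)
      finally have main: "N \<le> (\<Sum>x\<in>V - U. N * wdeg V w {x})
          + (\<Sum>v\<in>U. N * (\<Sum>e\<in>Pow V. if v \<in> e then link v (e - {v}) else 0))
          + (\<Sum>A\<in>Sat. N * wdeg V w A)"
        using N unfolding sum_distrib_left[symmetric] by (simp flip: distrib_left)
      have deg1: "N * wdeg V w A \<le> (K / p) * p ^ card A" if "A \<noteq> {}" for A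
        using wdeg[OF that] p by (simp add: field_simps)
      have "(\<Sum>x\<in>V - U. N * wdeg V w {x}) \<le> (\<Sum>x\<in>V - U. K)"
        using deg1[of "{_}"] p by (intro sum_mono) auto
      then have 1: "(\<Sum>x\<in>V - U. N * wdeg V w {x}) \<le> real (card (V - U)) * K" by simp
      have 2: "(\<Sum>v\<in>U. N * (\<Sum>e\<in>Pow V. if v \<in> e then link v (e - {v}) else 0)) \<le> (\<Sum>v\<in>U. 1 / 4)"
      proof (rule sum_mono)
        fix v assume v: "v \<in> U"
        have "(\<Sum>e\<in>Pow V. if v \<in> e then link v (e - {v}) else 0) = (\<Sum>e\<in>{e\<in>Pow V. v \<in> e}. link v (e - {v}))"
          using fin by (subst sum.inter_filter) auto
        also have "\<dots> = (\<Sum>e\<in>(\<lambda>e. e - {v}) ` {e\<in>Pow V. v \<in> e}. link v e)"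
          by (subst sum.reindex) (auto simp: inj_on_def)
        also have "\<dots> \<le> wdeg V (link v) {}"
          unfolding wdeg_def using V link0 by (intro sum_mono2) auto
        finally have "4 * N * (\<Sum>e\<in>Pow V. if v \<in> e then link v (e - {v}) else 0) \<le> 4 * N * wdeg V (link v) {}"
          using N by (intro mult_left_mono) auto
        also have "\<dots> \<le> 1" using False v by force
        finally show "N * (\<Sum>e\<in>Pow V. if v \<in> e then link v (e - {v}) else 0) \<le> 1 / 4" by simp
      qed
      have "real (card U) \<le> N" using U V card_mono unfolding N_def by auto
      then have 2: "(\<Sum>v\<in>U. N * (\<Sum>e\<in>Pow V. if v \<in> e then link v (e - {v}) else 0)) \<le> N / 4"
        using 2 by simp
      have "(\<Sum>A\<in>Sat. N * wdeg V w A) \<le> (\<Sum>A\<in>Sat. K / (p * (K' - K)) * N * wdeg V u A)"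
      proof (rule sum_mono)
        fix A assume A: "A \<in> Sat"
        then have "N * wdeg V w A \<le> (K / p) * p ^ card A" by (intro deg1) (auto simp: Sat_def)
        also have "\<dots> = K / (p * (K' - K)) * ((K' - K) * p ^ card A)" using K'K p by (simp add: field_simps)
        also have "\<dots> \<le> K / (p * (K' - K)) * (N * wdeg V u A)"
          using A K'K p K by (intro mult_left_mono) (auto simp: Sat_def)
        finally show "N * wdeg V w A \<le> K / (p * (K' - K)) * N * wdeg V u A" by simp
      qed
      also have "\<dots> = K / (p * (K' - K)) * N * (\<Sum>A\<in>Sat. wdeg V u A)"
        by (simp add: sum_distrib_left)
      also have "\<dots> \<le> K / (p * (K' - K)) * N * (2 ^ s * wdeg V u {})"
        using K'K p K N u0 ucard V by (intro mult_left_mono sum_wdeg_le) (auto simp: Sat_def)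
      also have "\<dots> = K / (p * (K' - K)) * 2 ^ s * (N * wdeg V u {})" by simp
      also have "\<dots> \<le> K / (p * (K' - K)) * 2 ^ s * (2 * (p * N) * K)"
      proof (rule mult_left_mono)
        have "real m * K \<le> 2 * (p * N) * K" using mq q(1) K by (intro mult_right_mono) auto
        then show "N * wdeg V u {} \<le> 2 * (p * N) * K" using utot(2) by linarith
      qed (use K K'K p in auto)
      \<comment> \<open>This fixes \<open>K'\<close>: the gap
        \<open>K' - K = 2 ^ (s + 3) * K\<^sup>2\<close> makes the bound exactly
        \<open>N / 4\<close>.\<close>
      also have "\<dots> = N / 4"
        using K p unfolding K' by (simp add: field_simps power_add power2_eq_square)
      finally have 3: "(\<Sum>A\<in>Sat. N * wdeg V w A) \<le> N / 4" .
      have VU: "N \<le> 2 * (real (card (V - U)) * K)" using main 1 2 3 by linarith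
      have cVU: "real (card (V - U)) = N - real (card U)"
        using U V finU card_mono[OF V(1) U] by (simp add: N_def card_Diff_subset of_nat_diff)
      have "real (card (U \<union> T)) \<le> real (card U) + real m" using card_Un_le[of U T] T by linarith
      also have "\<dots> \<le> real (card U) + 2 * (p * N)" using mq q(1) by linarith
      finally have c: "real (card (U \<union> T)) \<le> real (card U) + 2 * (p * N)" .
      \<comment> \<open>\<open>V - U\<close> has at least \<open>N / (2 * K)\<close> vertices;
        \<open>T\<close> takes back at most \<open>2 * p * N \<le> N / (4 * K)\<close>, and the
        remaining \<open>N / (4 * K)\<close> is at least \<open>\<delta> * N\<close>.\<close>
      have "4 * K * real (card (U \<union> T)) \<le> 4 * K * (real (card U) + 2 * (p * N))"
        using c K by (intro mult_left_mono) auto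
      also have "\<dots> = 4 * K * N - 4 * (real (card (V - U)) * K) + (8 * K * p) * N"
        by (simp add: cVU algebra_simps)
      also have "\<dots> \<le> 4 * K * N - 2 * N + 1 * N"
        using VU mult_right_mono[OF p(2), of N] N by linarith
      also have "\<dots> \<le> 4 * K * ((1 - \<delta>) * N)"
        using mult_right_mono[OF \<delta>, of N] N by (simp add: algebra_simps)
      finally have c: "real (card (U \<union> T)) \<le> (1 - \<delta>) * N" using K by simp
      have B1: "1 \<le> (1 + p) ^ card U * (1 / p) ^ (q - m) * B"
      proof -
        have "1 \<le> (1 + p) ^ card U" using p by (intro one_le_power) auto
        moreover have "1 \<le> (1 / p) ^ (q - m)" using p by (intro one_le_power) auto
        ultimately show ?thesis using B by (simp add: mult_ge1_I)
      qed
      show ?thesis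
        by (rule exI[of _ "{U \<union> T}"]) (use B1 c U T in auto)
    qed
  qed
qed

text \<open>The degree condition is the usual \<open>deg A \<le> K p\<^sup>|\<^sup>A\<^sup>|\<^sup>-\<^sup>1 / |V|\<close>, multiplied out to avoid truncated
  subtraction in the exponent.\<close>

definition spread :: "'a set \<Rightarrow> ('a set \<Rightarrow> real) \<Rightarrow> nat \<Rightarrow> real \<Rightarrow> real \<Rightarrow> bool" where
  "spread V w s K p \<longleftrightarrow> (\<forall>e. 0 \<le> w e) \<and> (\<forall>e. w e \<noteq> 0 \<longrightarrow> card e = s) \<and> 1 \<le> wdeg V w {} \<and>
     (\<forall>A. A \<noteq> {} \<longrightarrow> p * real (card V) * wdeg V w A \<le> K * p ^ card A)"

definition has_containers :: "'a set \<Rightarrow> ('a set \<Rightarrow> real) \<Rightarrow> real \<Rightarrow> real \<Rightarrow> bool" where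
  "has_containers V w \<delta> B \<longleftrightarrow>
     (\<exists>\<C>. finite \<C> \<and> real (card \<C>) \<le> B \<and>
       (\<forall>C\<in>\<C>. C \<subseteq> V \<and> real (card C) \<le> (1 - \<delta>) * real (card V)) \<and>
       (\<forall>I\<subseteq>V. windep V w I \<longrightarrow> (\<exists>C\<in>\<C>. I \<subseteq> C)))"

text \<open>In uniformity 1 an independent set just avoids the support \<open>S\<close>, so
  \<open>V - S\<close> is the only container; it is small because each vertex carries weight at most
  \<open>K / N\<close> of a total of at least 1.\<close>

lemma has_containers_base:
  assumes V: "finite V" and w: "spread V w 1 K p" and p: "0 < p" and K: "0 < K" "K * \<delta> \<le> 1"
  shows "has_containers V w \<delta> 1"
proof -
  define N where "N = real (card V)"
  define S where "S = {x\<in>V. 0 < w {x}}"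
  have w0: "0 \<le> w e" and wcard: "w e \<noteq> 0 \<Longrightarrow> card e = 1" for e
    using w by (auto simp: spread_def)
  have finS: "finite S" using V by (simp add: S_def)
  have "1 \<le> (\<Sum>e\<in>Pow V. w e)" using w by (simp add: spread_def wdeg_indicator[OF V])
  also have "\<dots> = (\<Sum>e\<in>(\<lambda>x. {x}) ` S. w e)"
  proof (intro sum.mono_neutral_right ballI)
    fix e assume e: "e \<in> Pow V - (\<lambda>x. {x}) ` S"
    show "w e = 0"
    proof (rule ccontr)
      assume ne: "w e \<noteq> 0"
      then obtain x where "e = {x}" using wcard card_1_singletonE by blast
      then show False using e ne w0[of e] by (auto simp: S_def)
    qed
  qed (use V in \<open>auto simp: S_def\<close>)
  also have "\<dots> = (\<Sum>x\<in>S. w {x})" by (subst sum.reindex) (auto simp: inj_on_def)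
  also have "\<dots> \<le> (\<Sum>x\<in>S. wdeg V w {x})"
  proof (rule sum_mono)
    fix x assume "x \<in> S"
    then show "w {x} \<le> wdeg V w {x}"
      unfolding wdeg_def using V w0 by (intro member_le_sum) (auto simp: S_def)
  qed
  finally have "1 \<le> (\<Sum>x\<in>S. wdeg V w {x})" .
  then have "N * 1 \<le> N * (\<Sum>x\<in>S. wdeg V w {x})" by (intro mult_left_mono) (auto simp: N_def)
  also have "\<dots> = (\<Sum>x\<in>S. N * wdeg V w {x})" by (rule sum_distrib_left)
  also have "\<dots> \<le> (\<Sum>x\<in>S. K)"
  proof (rule sum_mono)
    fix x
    have "p * N * wdeg V w {x} \<le> K * p ^ card {x}"
      using w unfolding spread_def N_def by blast
    then show "N * wdeg V w {x} \<le> K" using p by (simp add: algebra_simps)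
  qed
  finally have NS: "N \<le> real (card S) * K" by simp
  have "N * (K * \<delta>) \<le> N * 1" using K by (intro mult_left_mono) (auto simp: N_def)
  then have "K * (N * \<delta>) \<le> K * real (card S)" using NS by (simp add: algebra_simps)
  then have "N * \<delta> \<le> real (card S)" using K by simp
  moreover have "real (card (V - S)) = N - real (card S)"
    using V finS card_mono[of V S] by (simp add: N_def S_def card_Diff_subset of_nat_diff)
  ultimately have c: "real (card (V - S)) \<le> (1 - \<delta>) * N" by (simp add: algebra_simps)
  have "I \<subseteq> V - S" if "I \<subseteq> V" "windep V w I" for I
  proof
    fix x assume "x \<in> I"
    then have "{x} \<subseteq> V" "{x} \<subseteq> I" using that by auto
    then show "x \<in> V - S" using that(2) unfolding windep_def S_def by blast
  qed
  then show ?thesis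
    unfolding has_containers_def using c by (intro exI[of _ "{V - S}"]) (auto simp: N_def)
qed

text \<open>Each application of \<open>container_branch\<close> lowers the uniformity by one and
  multiplies the number of containers by the same factor, whence the power \<open>s\<close>. The
  constant \<open>\<delta>\<close> is fixed before \<open>V\<close>, \<open>w\<close> and
  \<open>p\<close>, since only \<open>K\<close> changes from level to level, to
  \<open>4 * K'\<close>.\<close>

lemma hypergraph_containers:
  fixes K :: real
  assumes "0 < K"
  shows "\<exists>\<delta>>0. \<delta> < 1 \<and> (\<forall>(V :: 'a set) w p. finite V \<longrightarrow> spread V w (Suc s) K p \<longrightarrow> 0 < p \<longrightarrow> p \<le> \<delta> \<longrightarrow>
     1 \<le> p * real (card V) \<longrightarrow>
     has_containers V w \<delta> (((1 + p) ^ card V * (1 / p) ^ nat \<lceil>p * real (card V)\<rceil>) ^ s))"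
  using assms
proof (induction s arbitrary: K)
  case 0
  show ?case
    using 0 by (intro exI[of _ "min (1 / K) (1 / 2)"])
      (auto intro!: has_containers_base[where K = K] simp: min_def field_simps)
next
  case (Suc s)
  define K' where "K' = K + 2 ^ (Suc s + 3) * K\<^sup>2"
  have "0 < 4 * K'" using Suc.prems by (simp add: K'_def add_pos_nonneg)
  from Suc.IH[OF this] obtain \<delta>' where \<delta>': "0 < \<delta>'" "\<delta>' < 1"
    and IH: "\<And>(V :: 'a set) w p. finite V \<Longrightarrow> spread V w (Suc s) (4 * K') p \<Longrightarrow> 0 < p \<Longrightarrow> p \<le> \<delta>' \<Longrightarrow>
     1 \<le> p * real (card V) \<Longrightarrow>
     has_containers V w \<delta>' (((1 + p) ^ card V * (1 / p) ^ nat \<lceil>p * real (card V)\<rceil>) ^ s)"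
    by auto
  \<comment> \<open>\<open>1 / (8 * K)\<close> serves twice: it bounds \<open>p\<close> through
    \<open>p \<le> \<delta>\<close> and gives \<open>4 * K * \<delta> \<le> 1\<close>.\<close>
  define \<delta> where "\<delta> = min \<delta>' (1 / (8 * K))"
  have "8 * K * \<delta> \<le> 8 * K * (1 / (8 * K))"
    using Suc.prems unfolding \<delta>_def by (intro mult_left_mono) auto
  then have \<delta>: "0 < \<delta>" "\<delta> < 1" "\<delta> \<le> \<delta>'" "8 * K * \<delta> \<le> 1"
    using \<delta>' Suc.prems by (auto simp: \<delta>_def)
  have main: "has_containers V w \<delta> (((1 + p) ^ card V * (1 / p) ^ nat \<lceil>p * real (card V)\<rceil>) ^ Suc s)"
    if V: "finite V" and w: "spread V w (Suc (Suc s)) K p" and p: "0 < p" "p \<le> \<delta>"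
      and pV: "1 \<le> p * real (card V)" for V :: "'a set" and w p
  proof -
    define q where "q = nat \<lceil>p * real (card V)\<rceil>"
    define B where "B = ((1 + p) ^ card V * (1 / p) ^ q) ^ s"
    have ne: "V \<noteq> {}" using pV by auto
    have q: "real q \<le> 2 * (p * real (card V))" "p * real (card V) \<le> real q"
      unfolding q_def using pV by linarith+
    have p8: "8 * K * p \<le> 1"
    proof -
      have "8 * K * p \<le> 8 * K * \<delta>" using p Suc.prems by (intro mult_left_mono) auto
      then show ?thesis using \<delta> by linarith
    qed
    have d4: "4 * K * \<delta> \<le> 1"
    proof -
      have "4 * K * \<delta> \<le> 8 * K * \<delta>" using \<delta> Suc.prems by simp
      then show ?thesis using \<delta> by linarith
    qed
    have "p \<le> 1" using p \<delta> by linarith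
    have B: "1 \<le> B"
      unfolding B_def using p \<open>p \<le> 1\<close> by (intro one_le_power mult_ge1_I) auto
    have w0: "0 \<le> w e" and wcard: "w e \<noteq> 0 \<Longrightarrow> card e = Suc (Suc s)" and wtot: "1 \<le> wdeg V w {}"
      and wd: "A \<noteq> {} \<Longrightarrow> p * real (card V) * wdeg V w A \<le> K * p ^ card A" for e A
      using w by (auto simp: spread_def)
    have nxt: "\<exists>\<C>. finite \<C> \<and> real (card \<C>) \<le> B \<and>
          (\<forall>C\<in>\<C>. C \<subseteq> V \<and> real (card C) \<le> (1 - \<delta>) * real (card V)) \<and>
          (\<forall>I\<subseteq>V. windep V u I \<longrightarrow> (\<exists>C\<in>\<C>. I \<subseteq> C))"
      if u: "\<And>e. 0 \<le> u e" "\<And>e. u e \<noteq> 0 \<Longrightarrow> card e = Suc s" "1 \<le> wdeg V u {}"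
        "\<And>A. A \<noteq> {} \<Longrightarrow> p * real (card V) * wdeg V u A \<le> 4 * K' * p ^ card A" for u
    proof -
      have "spread V u (Suc s) (4 * K') p" using u by (simp add: spread_def)
      then have "has_containers V u \<delta>' B"
        unfolding B_def q_def using V p \<delta> pV by (intro IH) auto
      moreover have "(1 - \<delta>') * real (card V) \<le> (1 - \<delta>) * real (card V)"
        using \<delta> by (intro mult_right_mono) auto
      ultimately show ?thesis unfolding has_containers_def by (meson order.trans)
    qed
    \<comment> \<open>Root of the decision tree: \<open>U = V\<close>, \<open>T = {}\<close>,
      \<open>m = 0\<close> and the zero weight for \<open>u\<close>.\<close>
    have "\<exists>\<C>. finite \<C> \<and> real (card \<C>) \<le> (1 + p) ^ card V * (1 / p) ^ (q - 0) * B \<and>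
       (\<forall>C\<in>\<C>. C \<subseteq> V \<and> real (card C) \<le> (1 - \<delta>) * real (card V)) \<and>
       (\<forall>I\<subseteq>V. windep V w I \<longrightarrow> windep V (\<lambda>_. 0) I \<longrightarrow> I \<inter> (V - V) = {} \<longrightarrow> (\<exists>C\<in>\<C>. I \<subseteq> C))"
    proof (rule container_branch[OF V ne w0 wcard wtot wd p(1) p8 \<open>p \<le> 1\<close> Suc.prems q K'_def d4 B nxt])
      show "real (card V) * wdeg V (\<lambda>_. 0) A \<le> K' * p ^ card A" for A
        using p \<open>0 < 4 * K'\<close> by (simp add: wdeg_def)
    qed (simp_all add: wdeg_def)
    moreover have "windep V (\<lambda>_. 0) I" for I by (simp add: windep_def)
    ultimately show ?thesis
      unfolding has_containers_def B_def q_def by simp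
  qed
  show ?case by (intro exI[of _ \<delta>] conjI allI impI \<delta>(1,2)) (rule main; assumption)
qed

section \<open>Weighted homomorphisms from stacked trees\<close>

text \<open>Vertex set \<open>U\<close>, edges \<open>\<E>\<close>, and the list of \<open>(r - 1)\<close>-sets along which new edges were glued.\<close>

inductive stacked :: "nat \<Rightarrow> 'v set \<Rightarrow> 'v set set \<Rightarrow> 'v set list \<Rightarrow> bool" for r where
  base: "finite E \<Longrightarrow> card E = r \<Longrightarrow> stacked r E {E} []"
| step: "stacked r U \<E> L \<Longrightarrow> E \<in> \<E> \<Longrightarrow> u \<in> E \<Longrightarrow> v \<notin> U \<Longrightarrow>
    stacked r (insert v U) (insert (insert v (E - {u})) \<E>) ((E - {u}) # L)"

lemma stacked_props:
  assumes "stacked r U \<E> L"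
  shows "finite U" "E \<in> \<E> \<Longrightarrow> E \<subseteq> U \<and> card E = r" "F \<in> set L \<Longrightarrow> F \<subseteq> U"
    "card U = r + length L"
proof -
  have "finite U \<and> (\<forall>E\<in>\<E>. E \<subseteq> U \<and> card E = r) \<and> (\<forall>F\<in>set L. F \<subseteq> U) \<and> card U = r + length L"
    using assms
  proof induction
    case (step U \<E> L E u v)
    have E: "E \<subseteq> U" "card E = r" "finite E" using step finite_subset by auto
    then have "card (insert v (E - {u})) = r"
      using step.hyps card_Suc_Diff1[of E u] by (subst card_insert_disjoint) auto
    then show ?case using step E by auto
  qed auto
  then show "finite U" "E \<in> \<E> \<Longrightarrow> E \<subseteq> U \<and> card E = r" "F \<in> set L \<Longrightarrow> F \<subseteq> U"
    "card U = r + length L" by auto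
qed

text \<open>The neighbourhood of an \<open>(r - 1)\<close>-set; its size is the codegree. In an
  \<open>r\<close>-uniform \<open>G\<close> no element of such an \<open>f\<close> belongs to
  it.\<close>

definition ext :: "'a set set \<Rightarrow> 'a set \<Rightarrow> 'a set" where
  "ext G f = {x. insert x f \<in> G}"

text \<open>Maps need not be injective on \<open>U\<close>: the reversible process must be able to
  choose each new vertex from the whole of \<open>ext\<close>. Injectivity is imposed only when the
  maps are turned into cycles.\<close>

definition homs :: "'a set set \<Rightarrow> 'v set \<Rightarrow> 'v set set \<Rightarrow> ('v \<Rightarrow> 'a) set" where
  "homs G U \<E> = {\<phi> \<in> U \<rightarrow>\<^sub>E \<Union>G. \<forall>E\<in>\<E>. \<phi> ` E \<in> G}"

definition wt :: "'a set set \<Rightarrow> 'v set list \<Rightarrow> ('v \<Rightarrow> 'a) \<Rightarrow> real" where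
  "wt G L \<phi> = (\<Prod>F\<leftarrow>L. 1 / real (card (ext G (\<phi> ` F))))"

lemma wt_nonneg: "0 \<le> wt G L \<phi>"
  unfolding wt_def by (induction L) auto

lemma wt_Cons: "wt G (F # L) \<phi> = wt G L \<phi> / real (card (ext G (\<phi> ` F)))"
  by (simp add: wt_def)

lemma wt_upd:
  assumes "v \<notin> U" "\<And>F. F \<in> set L \<Longrightarrow> F \<subseteq> U"
  shows "wt G L (\<phi>(v := x)) = wt G L \<phi>"
proof -
  have "(\<phi>(v := x)) ` F = \<phi> ` F" if "F \<in> set L" for F
    using assms(1) assms(2)[OF that] by (auto simp: image_iff)
  then show ?thesis unfolding wt_def by (simp cong: map_cong)
qed

locale full_hypergraph =
  fixes G :: "'a set set" and r :: nat and D :: real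
  assumes finG: "finite G" and uniform: "e \<in> G \<Longrightarrow> card e = r"
    and r: "0 < r" and D: "0 < D"
    and full: "e \<in> G \<Longrightarrow> x \<in> e \<Longrightarrow> D \<le> real (card (ext G (e - {x})))"
begin

lemma finite_edge: "e \<in> G \<Longrightarrow> finite e"
  using uniform r card_ge_0_finite by force

lemma finite_ext: "finite (ext G f)"
proof (rule finite_subset)
  show "ext G f \<subseteq> \<Union>G" by (auto simp: ext_def)
  show "finite (\<Union>G)" using finG finite_edge by auto
qed

lemma finite_homs: "finite U \<Longrightarrow> finite (homs G U \<E>)"
  unfolding homs_def using finG finite_edge by (simp add: finite_PiE)

lemma homs_inj:
  assumes "stacked r U \<E> L" "\<phi> \<in> homs G U \<E>" "E \<in> \<E>"
  shows "inj_on \<phi> E"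
proof (rule eq_card_imp_inj_on)
  show "finite E" 
    using stacked_props(2)[OF assms(1,3)] finite_subset[OF _ stacked_props(1)[OF assms(1)]] by simp
  show "card (\<phi> ` E) = card E"
    using stacked_props(2)[OF assms(1,3)] uniform[of "\<phi> ` E"] assms(2,3) by (simp add: homs_def)
qed

lemma homs_codegree:
  assumes "stacked r U \<E> L" "\<phi> \<in> homs G U \<E>" "E \<in> \<E>" "u \<in> E"
  shows "D \<le> real (card (ext G (\<phi> ` (E - {u}))))"
proof -
  have "\<phi> ` (E - {u}) = \<phi> ` E - {\<phi> u}"
    using homs_inj[OF assms(1-3)] assms(4) by (auto simp: inj_on_def)
  then show ?thesis using full[of "\<phi> ` E" "\<phi> u"] assms by (auto simp: homs_def)
qed

text \<open>The new vertex lies in exactly one edge, the new one, so a homomorphism of the enlarged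
  pattern is a homomorphism of the old one plus an arbitrary element of \<open>ext\<close>.\<close>

lemma sum_homs_insert:
  assumes st: "stacked r U \<E> L" and E: "E \<in> \<E>" "u \<in> E" and v: "v \<notin> U"
  shows "(\<Sum>\<phi>\<in>homs G (insert v U) (insert (insert v (E - {u})) \<E>). g \<phi>) =
    (\<Sum>\<phi>\<in>homs G U \<E>. \<Sum>x\<in>ext G (\<phi> ` (E - {u})). g (\<phi>(v := x)))"
proof -
  define F where "F = E - {u}"
  have sub: "E' \<subseteq> U" if "E' \<in> \<E>" for E' using stacked_props(2)[OF st that] by simp
  have F: "F \<subseteq> U" using sub[OF E(1)] by (auto simp: F_def)
  have upd: "(\<phi>(v := x)) ` A = \<phi> ` A" if "A \<subseteq> U" for \<phi> :: "'b \<Rightarrow> 'a" and x A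
    using that v by (auto simp: image_iff)
  have "homs G (insert v U) (insert (insert v F) \<E>) =
      (\<lambda>(\<phi>, x). \<phi>(v := x)) ` (SIGMA \<phi>:homs G U \<E>. ext G (\<phi> ` F))" (is "?A = ?f ` ?B")
  proof (intro equalityI subsetI)
    fix \<psi> assume \<psi>: "\<psi> \<in> ?A"
    define \<phi> where "\<phi> = \<psi>(v := undefined)"
    have "\<phi> ` A = \<psi> ` A" if "A \<subseteq> U" for A unfolding \<phi>_def by (rule upd[OF that])
    then have img: "\<phi> ` F = \<psi> ` F" "\<And>E'. E' \<in> \<E> \<Longrightarrow> \<phi> ` E' = \<psi> ` E'" using F sub by auto
    have \<psi>U: "\<psi> \<in> insert v U \<rightarrow>\<^sub>E \<Union>G" using \<psi> by (simp add: homs_def)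
    have "\<phi> \<in> U \<rightarrow>\<^sub>E \<Union>G"
    proof (rule PiE_I)
      show "\<phi> x \<in> \<Union>G" if "x \<in> U" for x
        using PiE_mem[OF \<psi>U, of x] that v by (auto simp: \<phi>_def)
      show "\<phi> x = undefined" if "x \<notin> U" for x
        using PiE_arb[OF \<psi>U, of x] that by (auto simp: \<phi>_def)
    qed
    then have "\<phi> \<in> homs G U \<E>" using \<psi> img by (auto simp: homs_def)
    moreover have "\<psi> v \<in> ext G (\<phi> ` F)" using \<psi> img by (auto simp: homs_def ext_def)
    moreover have "\<psi> = \<phi>(v := \<psi> v)" by (simp add: \<phi>_def)
    ultimately show "\<psi> \<in> ?f ` ?B" by (intro image_eqI[of _ _ "(\<phi>, \<psi> v)"]) auto
  next
    fix \<psi> assume "\<psi> \<in> ?f ` ?B"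
    then obtain \<phi> x where \<phi>: "\<psi> = \<phi>(v := x)" "\<phi> \<in> homs G U \<E>" "insert x (\<phi> ` F) \<in> G"
      by (auto simp: ext_def)
    have img: "\<psi> ` F = \<phi> ` F" "\<And>E'. E' \<in> \<E> \<Longrightarrow> \<psi> ` E' = \<phi> ` E'" using upd F sub \<phi>(1) by auto
    have "\<psi> \<in> insert v U \<rightarrow>\<^sub>E \<Union>G" unfolding \<phi>(1) using \<phi>(2,3)
      by (intro fun_upd_in_PiE PiE_fun_upd) (auto simp: homs_def)
    moreover have "\<psi> v = x" using \<phi>(1) by simp
    then have "\<psi> ` insert v F \<in> G" using \<phi>(3) img(1) by (simp only: image_insert)
    ultimately show "\<psi> \<in> ?A" using \<phi>(2) img by (auto simp: homs_def)
  qed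
  moreover have "inj_on ?f ?B"
  proof (rule inj_onI, clarify)
    fix \<phi> x \<phi>' x'
    assume \<phi>: "\<phi> \<in> homs G U \<E>" "\<phi>' \<in> homs G U \<E>" and eq: "\<phi>(v := x) = \<phi>'(v := x')"
    have "\<phi> v = undefined" "\<phi>' v = undefined" using \<phi> v by (auto simp: homs_def dest: PiE_arb)
    then show "\<phi> = \<phi>' \<and> x = x'" using eq by (metis fun_upd_same fun_upd_triv fun_upd_upd)
  qed
  ultimately have "(\<Sum>\<phi>\<in>homs G (insert v U) (insert (insert v F) \<E>). g \<phi>) =
     (\<Sum>(\<phi>, x)\<in>(SIGMA \<phi>:homs G U \<E>. ext G (\<phi> ` F)). g (\<phi>(v := x)))"
    by (simp add: sum.reindex case_prod_unfold)
  also have "\<dots> = (\<Sum>\<phi>\<in>homs G U \<E>. \<Sum>x\<in>ext G (\<phi> ` F). g (\<phi>(v := x)))"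
    using finite_homs[OF stacked_props(1)[OF st]] finite_ext by (subst sum.Sigma) auto
  finally show ?thesis by (simp add: F_def)
qed

text \<open>
  Up to normalisation, \<open>wt\<close> is the law of the random homomorphism that starts with a uniform edge and
  chooses every further vertex uniformly. The bound says that this law does not depend on which edge
  of the pattern comes first, so \<open>E0\<close> may be taken as the root; every other fixed vertex then
  contributes a factor \<open>1 / D\<close>.
\<close>

lemma sum_wt_fixed_le:
  assumes "stacked r U \<E> L" "S \<subseteq> U" "E0 \<in> \<E>" "E0 \<subseteq> S"
  shows "(\<Sum>\<phi>\<in>homs G U \<E>. if \<forall>s\<in>S. \<phi> s = \<sigma> s then wt G L \<phi> else 0) \<le> (1 / D) ^ (card S - r)"
  using assms
proof (induction arbitrary: S \<sigma> E0)
  case (base E)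
  then have S: "S = E" by auto
  have "(\<Sum>\<phi>\<in>homs G E {E}. if \<forall>s\<in>S. \<phi> s = \<sigma> s then wt G [] \<phi> else 0)
      \<le> (\<Sum>\<phi>\<in>homs G E {E}. if \<phi> = restrict \<sigma> E then 1 else 0)"
  proof (rule sum_mono)
    fix \<phi> assume "\<phi> \<in> homs G E {E}"
    then have \<phi>: "restrict \<phi> E = \<phi>" unfolding homs_def by (metis (lifting) PiE_restrict mem_Collect_eq)
    have "\<phi> = restrict \<sigma> E" if "\<forall>s\<in>E. \<phi> s = \<sigma> s"
      using that by (subst \<phi>[symmetric], intro restrict_ext) auto
    then show "(if \<forall>s\<in>S. \<phi> s = \<sigma> s then wt G [] \<phi> else 0) \<le> (if \<phi> = restrict \<sigma> E then 1 else 0)"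
      unfolding S by (cases "\<forall>s\<in>E. \<phi> s = \<sigma> s") (simp_all only: wt_def, simp_all)
  qed
  also have "\<dots> \<le> 1" by (simp add: finite_homs[OF base(1)])
  finally show ?case using base S by simp
next
  case (step U \<E> L E u v)
  define F where "F = E - {u}"
  note st = step.hyps(1)
  note sh = sum_homs_insert[OF st step.hyps(2-4), folded F_def]
  have EU: "E \<subseteq> U" "finite U" using stacked_props[OF st] step.hyps by auto
  let ?P = "\<lambda>S \<sigma> \<phi>. \<forall>s\<in>S. \<phi> s = \<sigma> s"
  let ?d = "\<lambda>\<phi>. real (card (ext G (\<phi> ` F)))"
  have wtu: "wt G (F # L) (\<phi>(v := x)) = wt G L \<phi> / ?d \<phi>" for \<phi> :: "'b \<Rightarrow> 'a" and x
  proof -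
    have "wt G (F # L) (\<phi>(v := x)) = wt G (F # L) \<phi>"
      by (rule wt_upd[of v U]) (use step.hyps EU stacked_props(3)[OF st] in \<open>auto simp: F_def\<close>)
    then show ?thesis by (simp add: wt_Cons)
  qed
  have sum_eq: "(\<Sum>\<phi>\<in>homs G (insert v U) (insert (insert v (E - {u})) \<E>).
        if ?P S \<sigma> \<phi> then wt G ((E - {u}) # L) \<phi> else 0)
      = (\<Sum>\<phi>\<in>homs G U \<E>. \<Sum>x\<in>ext G (\<phi> ` F). if ?P S \<sigma> (\<phi>(v := x)) then wt G L \<phi> / ?d \<phi> else 0)"
    unfolding F_def[symmetric] sh wtu ..
  show ?case
  proof (cases "v \<in> S")
    case False
    then have P: "?P S \<sigma> (\<phi>(v := x)) \<longleftrightarrow> ?P S \<sigma> \<phi>" for \<phi> x by auto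
    \<comment> \<open>A free new vertex is summed out: the \<open>?d \<phi>\<close> choices cancel
      the factor \<open>1 / ?d \<phi>\<close>.\<close>
    have "(\<Sum>\<phi>\<in>homs G U \<E>. \<Sum>x\<in>ext G (\<phi> ` F). if ?P S \<sigma> (\<phi>(v := x)) then wt G L \<phi> / ?d \<phi> else 0)
      \<le> (\<Sum>\<phi>\<in>homs G U \<E>. if ?P S \<sigma> \<phi> then wt G L \<phi> else 0)"
      unfolding P by (intro sum_mono) (auto simp: wt_nonneg)
    also have "\<dots> \<le> (1 / D) ^ (card S - r)"
      using step.prems False by (intro step.IH[of S E0]) auto
    finally show ?thesis unfolding sum_eq .
  next
    case True
    define S' where "S' = S - {v}"
    have "finite S" using finite_subset[OF step.prems(1)] EU by simp
    then have S': "S' \<subseteq> U" "finite S'" "card S = Suc (card S')"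
      using step.prems(1) card.remove[OF \<open>finite S\<close> True] by (auto simp: S'_def)
    have P: "?P S \<sigma> (\<phi>(v := x)) \<longleftrightarrow> ?P S' \<sigma> \<phi> \<and> x = \<sigma> v" for \<phi> x
      using True by (auto simp: S'_def)
    have inner: "(\<Sum>x\<in>ext G (\<phi> ` F). if ?P S \<sigma> (\<phi>(v := x)) then wt G L \<phi> / ?d \<phi> else 0)
        \<le> (if ?P S' \<sigma> \<phi> then wt G L \<phi> / ?d \<phi> else 0)" for \<phi>
    proof -
      have "(\<Sum>x\<in>ext G (\<phi> ` F). if Q \<and> x = \<sigma> v then c else 0) \<le> (if Q then c else 0)"
        if "0 \<le> c" for Q and c :: real
        using that by (cases Q) (simp_all add: finite_ext)
      then show ?thesis unfolding P by (simp add: wt_nonneg)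
    qed
    show ?thesis
    proof (cases "\<exists>E1\<in>\<E>. E1 \<subseteq> S'")
      case True
      then obtain E1 where E1: "E1 \<in> \<E>" "E1 \<subseteq> S'" by blast
      \<comment> \<open>An old edge can still serve as root, so prescribing the value of
        \<open>v\<close> costs \<open>1 / ?d \<phi> \<le> 1 / D\<close>.\<close>
      have rS: "r \<le> card S'" using stacked_props(2)[OF st E1(1)] E1(2) S'(2) card_mono by auto
      have "(\<Sum>\<phi>\<in>homs G U \<E>. \<Sum>x\<in>ext G (\<phi> ` F). if ?P S \<sigma> (\<phi>(v := x)) then wt G L \<phi> / ?d \<phi> else 0)
        \<le> (\<Sum>\<phi>\<in>homs G U \<E>. (1 / D) * (if ?P S' \<sigma> \<phi> then wt G L \<phi> else 0))"
      proof (intro sum_mono order.trans[OF inner])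
        fix \<phi> assume \<phi>: "\<phi> \<in> homs G U \<E>"
        have "D \<le> ?d \<phi>" unfolding F_def using homs_codegree[OF st \<phi> step.hyps(2,3)] .
        then have "wt G L \<phi> / ?d \<phi> \<le> wt G L \<phi> / D"
          using D wt_nonneg by (intro divide_left_mono) auto
        then show "(if ?P S' \<sigma> \<phi> then wt G L \<phi> / ?d \<phi> else 0)
           \<le> (1 / D) * (if ?P S' \<sigma> \<phi> then wt G L \<phi> else 0)" by simp
      qed
      also have "\<dots> = (1 / D) * (\<Sum>\<phi>\<in>homs G U \<E>. if ?P S' \<sigma> \<phi> then wt G L \<phi> else 0)"
        by (rule sum_distrib_left[symmetric])
      also have "\<dots> \<le> (1 / D) * (1 / D) ^ (card S' - r)"
        using D S' E1 by (intro mult_left_mono step.IH[of S' E1]) auto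
      also have "\<dots> = (1 / D) ^ (card S - r)" using rS S'(3) by (simp add: Suc_diff_le)
      finally show ?thesis unfolding sum_eq .
    next
      case False
      \<comment> \<open>The root is the newest edge: move it to \<open>E\<close>, summing over the unknown value of \<open>u\<close>.\<close>
      have "E0 \<notin> \<E>"
      proof
        assume E0: "E0 \<in> \<E>"
        then have "v \<notin> E0" using stacked_props(2)[OF st E0] step.hyps(4) by blast
        then have "E0 \<subseteq> S'" using step.prems(3) by (simp add: S'_def subset_Diff_insert)
        then show False using False E0 by blast
      qed
      then have "E0 = insert v F" using step.prems(2) by (simp add: F_def)
      moreover have "v \<notin> F" using EU(1) step.hyps(4) by (auto simp: F_def)
      ultimately have FS: "F \<subseteq> S'" using step.prems(3) by (simp add: S'_def subset_Diff_insert)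
      have uS: "u \<notin> S'"
      proof
        assume "u \<in> S'"
        then have "E \<subseteq> S'" using FS by (auto simp: F_def)
        then show False using False step.hyps by blast
      qed
      \<comment> \<open>Reversibility: both \<open>E\<close> and the newest edge extend
        \<open>F\<close>, and the image of \<open>F\<close> is prescribed. The factor
        \<open>1 / c\<close> for choosing \<open>v\<close> is cancelled by the at most
        \<open>c\<close> values \<open>y\<close> of \<open>u\<close>, so exchanging \<open>v\<close>
        for \<open>u\<close> among the fixed vertices is free.\<close>
      define c where "c = real (card (ext G (\<sigma> ` F)))"
      have img: "\<phi> ` F = \<sigma> ` F" if "?P S' \<sigma> \<phi>" for \<phi> using that FS by (auto simp: image_iff subset_iff)
      have "(\<Sum>\<phi>\<in>homs G U \<E>. \<Sum>x\<in>ext G (\<phi> ` F). if ?P S \<sigma> (\<phi>(v := x)) then wt G L \<phi> / ?d \<phi> else 0)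
        \<le> (\<Sum>\<phi>\<in>homs G U \<E>. (1 / c) * (\<Sum>y\<in>ext G (\<sigma> ` F).
              if ?P (insert u S') (\<sigma>(u := y)) \<phi> then wt G L \<phi> else 0))"
      proof (intro sum_mono order.trans[OF inner])
        fix \<phi> assume \<phi>: "\<phi> \<in> homs G U \<E>"
        show "(if ?P S' \<sigma> \<phi> then wt G L \<phi> / ?d \<phi> else 0) \<le> (1 / c) * (\<Sum>y\<in>ext G (\<sigma> ` F).
              if ?P (insert u S') (\<sigma>(u := y)) \<phi> then wt G L \<phi> else 0)"
        proof (cases "?P S' \<sigma> \<phi>")
          case True
          have "E = insert u F" using step.hyps by (auto simp: F_def)
          then have "insert (\<phi> u) (\<sigma> ` F) = \<phi> ` E" using img[OF True] by simp
          then have "\<phi> u \<in> ext G (\<sigma> ` F)" using \<phi> step.hyps by (auto simp: ext_def homs_def)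
          then have "wt G L \<phi> \<le> (\<Sum>y\<in>ext G (\<sigma> ` F).
              if ?P (insert u S') (\<sigma>(u := y)) \<phi> then wt G L \<phi> else 0)"
            using member_le_sum[of "\<phi> u" "ext G (\<sigma> ` F)"
              "\<lambda>y. if ?P (insert u S') (\<sigma>(u := y)) \<phi> then wt G L \<phi> else 0"] True uS
            by (auto simp: wt_nonneg finite_ext)
          then have "wt G L \<phi> / c \<le> (\<Sum>y\<in>ext G (\<sigma> ` F).
              if ?P (insert u S') (\<sigma>(u := y)) \<phi> then wt G L \<phi> else 0) / c"
            by (intro divide_right_mono) (auto simp: c_def)
          moreover have "?d \<phi> = c" using img[OF True] by (simp add: c_def)
          ultimately show ?thesis using True by simp
        next
          case False
          then show ?thesis unfolding if_not_P[OF False]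
            by (intro mult_nonneg_nonneg sum_nonneg) (simp_all add: c_def wt_nonneg)
        qed
      qed
      also have "\<dots> = (1 / c) * (\<Sum>y\<in>ext G (\<sigma> ` F). \<Sum>\<phi>\<in>homs G U \<E>.
              if ?P (insert u S') (\<sigma>(u := y)) \<phi> then wt G L \<phi> else 0)"
        unfolding sum_distrib_left[symmetric] by (subst sum.swap) (rule refl)
      also have "\<dots> \<le> (1 / c) * (\<Sum>y\<in>ext G (\<sigma> ` F). (1 / D) ^ (card (insert u S') - r))"
      proof (intro mult_left_mono sum_mono step.IH[of _ E])
        show "E \<subseteq> insert u S'" using FS by (auto simp: F_def)
      qed (use S' EU step.hyps in \<open>auto simp: c_def\<close>)
      also have "\<dots> = (c / c) * (1 / D) ^ (card S - r)" using uS S' by (simp add: c_def)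
      \<comment> \<open>Only an inequality, as \<open>c / c\<close> is \<open>0\<close> if
        \<open>c = 0\<close>.\<close>
      also have "\<dots> \<le> (1 / D) ^ (card S - r)" using D by simp
      finally show ?thesis unfolding sum_eq .
    qed
  qed
qed

text \<open>At each gluing step at most \<open>card U \<le> D / 2\<close> of the at least
  \<open>D\<close> choices collide with earlier images, so each step keeps at least half of the
  injective weight. The base case uses one bijection from the root onto each edge of
  \<open>G\<close>.\<close>

lemma sum_wt_inj_ge:
  assumes "stacked r U \<E> L" "2 * real (card U) \<le> D"
  shows "real (card G) * (1 / 2) ^ length L \<le> (\<Sum>\<phi>\<in>homs G U \<E>. if inj_on \<phi> U then wt G L \<phi> else 0)"
  using assms
proof induction
  case (base E)
  have "\<exists>h. bij_betw h E e" if "e \<in> G" for e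
    using that base uniform finite_edge by (intro finite_same_card_bij) auto
  then obtain h where h: "\<And>e. e \<in> G \<Longrightarrow> bij_betw (h e) E e" by metis
  define \<eta> where "\<eta> e = restrict (h e) E" for e
  have \<eta>: "bij_betw (\<eta> e) E e" if "e \<in> G" for e
    using h[OF that] unfolding \<eta>_def by (subst bij_betw_cong[of E _ "h e"]) auto
  have "card G \<le> card {\<phi>\<in>homs G E {E}. inj_on \<phi> E}"
  proof (rule card_inj_on_le[of \<eta>])
    show "inj_on \<eta> G" using \<eta> by (metis bij_betw_imp_surj_on inj_onI)
    show "\<eta> ` G \<subseteq> {\<phi>\<in>homs G E {E}. inj_on \<phi> E}"
    proof
      fix \<phi> assume "\<phi> \<in> \<eta> ` G"
      then obtain e where e: "e \<in> G" "\<phi> = \<eta> e" by blast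
      have "\<phi> \<in> E \<rightarrow>\<^sub>E \<Union>G"
        using e \<eta>[OF e(1)] bij_betwE[OF h[OF e(1)]] by (auto simp: \<eta>_def)
      then show "\<phi> \<in> {\<phi>\<in>homs G E {E}. inj_on \<phi> E}"
        using e \<eta>[OF e(1)] by (auto simp: homs_def bij_betw_def)
    qed
    show "finite {\<phi>\<in>homs G E {E}. inj_on \<phi> E}" using finite_homs[OF base(1)] by simp
  qed
  also have "real (card {\<phi>\<in>homs G E {E}. inj_on \<phi> E}) =
      (\<Sum>\<phi>\<in>homs G E {E}. if inj_on \<phi> E then wt G [] \<phi> else 0)"
    using finite_homs[OF base(1)] by (simp add: wt_def sum.inter_filter[symmetric])
  finally show ?case by simp
next
  case (step U \<E> L E u v)
  define F where "F = E - {u}"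
  note st = step.hyps(1)
  note sh = sum_homs_insert[OF st step.hyps(2-4), folded F_def]
  have EU: "E \<subseteq> U" "finite U" using stacked_props[OF st] step.hyps by auto
  let ?d = "\<lambda>\<phi>. real (card (ext G (\<phi> ` F)))"
  have wtu: "wt G (F # L) (\<phi>(v := x)) = wt G L \<phi> / ?d \<phi>" for \<phi> :: "'b \<Rightarrow> 'a" and x
  proof -
    have "wt G (F # L) (\<phi>(v := x)) = wt G (F # L) \<phi>"
      by (rule wt_upd[of v U]) (use step.hyps EU stacked_props(3)[OF st] in \<open>auto simp: F_def\<close>)
    then show ?thesis by (simp add: wt_Cons)
  qed
  have cU: "card (insert v U) = Suc (card U)" using EU step.hyps by simp
  have "real (card G) * (1 / 2) ^ length (F # L) \<le>
      (1 / 2) * (\<Sum>\<phi>\<in>homs G U \<E>. if inj_on \<phi> U then wt G L \<phi> else 0)"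
    using step.IH step.prems cU by simp
  also have "\<dots> = (\<Sum>\<phi>\<in>homs G U \<E>. (1 / 2) * (if inj_on \<phi> U then wt G L \<phi> else 0))"
    by (rule sum_distrib_left)
  also have "\<dots> \<le> (\<Sum>\<phi>\<in>homs G U \<E>. \<Sum>x\<in>ext G (\<phi> ` F).
      if inj_on (\<phi>(v := x)) (insert v U) then wt G L \<phi> / ?d \<phi> else 0)"
  proof (rule sum_mono)
    fix \<phi> assume \<phi>: "\<phi> \<in> homs G U \<E>"
    show "(1 / 2) * (if inj_on \<phi> U then wt G L \<phi> else 0) \<le> (\<Sum>x\<in>ext G (\<phi> ` F).
      if inj_on (\<phi>(v := x)) (insert v U) then wt G L \<phi> / ?d \<phi> else 0)"
    proof (cases "inj_on \<phi> U")
      case True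
      have d: "D \<le> ?d \<phi>" unfolding F_def using homs_codegree[OF st \<phi> step.hyps(2,3)] .
      have "inj_on (\<phi>(v := x)) (insert v U)" if "x \<notin> \<phi> ` U" for x
        using True that step.hyps(4) by (intro inj_onI) (auto simp: inj_on_def split: if_splits)
      then have "(\<Sum>x\<in>ext G (\<phi> ` F) - \<phi> ` U. wt G L \<phi> / ?d \<phi>) \<le>
         (\<Sum>x\<in>ext G (\<phi> ` F). if inj_on (\<phi>(v := x)) (insert v U) then wt G L \<phi> / ?d \<phi> else 0)"
        using finite_ext by (intro sum_le_included[where i = "\<lambda>x. x"]) (auto simp: wt_nonneg)
      moreover have "?d \<phi> / 2 \<le> real (card (ext G (\<phi> ` F) - \<phi> ` U))"
      proof -
        have "card (ext G (\<phi> ` F)) - card (\<phi> ` U) \<le> card (ext G (\<phi> ` F) - \<phi> ` U)"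
          using EU by (intro diff_card_le_card_Diff) auto
        moreover have "card (\<phi> ` U) \<le> card U" using EU by (intro card_image_le)
        ultimately show ?thesis using d step.prems cU by simp
      qed
      then have "(?d \<phi> / 2) * (wt G L \<phi> / ?d \<phi>) \<le>
          real (card (ext G (\<phi> ` F) - \<phi> ` U)) * (wt G L \<phi> / ?d \<phi>)"
        by (intro mult_right_mono) (auto simp: wt_nonneg)
      moreover have "(?d \<phi> / 2) * (wt G L \<phi> / ?d \<phi>) = (1 / 2) * wt G L \<phi>" using d D by simp
      moreover have "(\<Sum>x\<in>ext G (\<phi> ` F) - \<phi> ` U. wt G L \<phi> / ?d \<phi>) =
          real (card (ext G (\<phi> ` F) - \<phi> ` U)) * (wt G L \<phi> / ?d \<phi>)" by simp
      ultimately show ?thesis unfolding if_P[OF True] by linarith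
    next
      case False
      then show ?thesis by (auto intro!: sum_nonneg simp: wt_nonneg)
    qed
  qed
  also have "\<dots> = (\<Sum>\<phi>\<in>homs G (insert v U) (insert (insert v (E - {u})) \<E>).
      if inj_on \<phi> (insert v U) then wt G ((E - {u}) # L) \<phi> else 0)"
    unfolding F_def[symmetric] sh wtu ..
  finally show ?case by (simp only: F_def)
qed

end

section \<open>Full subgraphs and the linear cycle pattern\<close>

definition shadow :: "'a set set \<Rightarrow> 'a set set" where
  "shadow G = {e - {x} | e x. e \<in> G \<and> x \<in> e}"

lemma finite_shadow:
  assumes "finite G" "\<And>e. e \<in> G \<Longrightarrow> finite e"
  shows "finite (shadow G)"
proof (rule finite_subset)
  show "shadow G \<subseteq> (\<lambda>(e, x). e - {x}) ` (SIGMA e:G. e)"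
    by (auto simp: shadow_def intro!: image_eqI[of _ _ "(_, _)"])
qed (use assms in auto)

lemma exists_full_subgraph:
  fixes G :: "'a set set" and D :: real
  assumes fin: "finite G" and uniform: "\<And>e. e \<in> G \<Longrightarrow> card e = r" and r: "0 < r" and D: "0 \<le> D"
  shows "\<exists>G'\<subseteq>G. (\<forall>e\<in>G'. \<forall>x\<in>e. D \<le> real (card (ext G' (e - {x})))) \<and>
    real (card G) \<le> real (card G') + D * real (card (shadow G))"
proof -
  \<comment> \<open>Deleting the edges through a set of codegree below \<open>D\<close> would increase \<open>f\<close>, so a maximiser is full.\<close>
  define f where "f H = real (card H) - D * real (card (shadow H))" for H :: "'a set set"
  have fe: "finite e" if "e \<in> G" for e using uniform[OF that] r card_ge_0_finite by metis
  have "Max (f ` Pow G) \<in> f ` Pow G" using fin by (intro Max_in) auto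
  then obtain G' where G': "G' \<subseteq> G" "f G' = Max (f ` Pow G)" by auto
  have max: "f H \<le> f G'" if "H \<subseteq> G" for H
    unfolding G'(2) using that fin by (intro Max_ge) auto
  have finG': "finite G'" using G' fin finite_subset by auto
  have "D \<le> real (card (ext G' (e - {x})))" if e: "e \<in> G'" "x \<in> e" for e x
  proof (rule ccontr)
    assume less: "\<not> D \<le> real (card (ext G' (e - {x})))"
    define F where "F = e - {x}"
    define H where "H = {h\<in>G'. \<not> F \<subseteq> h}"
    have eG: "e \<in> G" using e G' by auto
    have cF: "Suc (card F) = r" "finite F"
      using card_Suc_Diff1[OF fe[OF eG] e(2)] uniform[OF eG] fe[OF eG] by (auto simp: F_def)
    have finext: "finite (ext G' F)"
    proof (rule finite_subset)
      show "ext G' F \<subseteq> \<Union>G'" by (auto simp: ext_def)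
      show "finite (\<Union>G')" using finG' fe G' by auto
    qed
    have "G' - H \<subseteq> (\<lambda>y. insert y F) ` ext G' F"
    proof
      fix h assume h: "h \<in> G' - H"
      then have hF: "h \<in> G'" "F \<subseteq> h" by (auto simp: H_def)
      then have "card (h - F) = 1"
        using uniform[of h] G' cF by (subst card_Diff_subset) auto
      then obtain y where "h - F = {y}" using card_1_singletonE by blast
      then have "h = insert y F" using hF by auto
      then show "h \<in> (\<lambda>y. insert y F) ` ext G' F" using hF by (auto simp: ext_def)
    qed
    then have "card (G' - H) \<le> card (ext G' F)"
      using finext by (meson card_image_le card_mono finite_imageI le_trans)
    moreover have "card G' = card (G' - H) + card H"
      using finG' card_Diff_subset[of H G'] card_mono[of G' H] finite_subset[of H G'] by (auto simp: H_def)
    ultimately have 1: "real (card G') - real (card H) < D" using less by (simp add: F_def)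
    have finsh: "finite (shadow G')" using finG' fe G' by (intro finite_shadow) auto
    have FG: "F \<in> shadow G'" using e by (auto simp: shadow_def F_def)
    have "shadow H \<subseteq> shadow G' - {F}" by (auto simp: shadow_def H_def)
    then have "card (shadow H) \<le> card (shadow G' - {F})" using finsh by (intro card_mono) auto
    also have "\<dots> < card (shadow G')" using finsh FG by (intro psubset_card_mono) auto
    finally have "real (card (shadow H)) + 1 \<le> real (card (shadow G'))" by simp
    then have "D * (real (card (shadow H)) + 1) \<le> D * real (card (shadow G'))"
      using D by (intro mult_left_mono) auto
    then have "f G' < f H" using 1 by (simp add: f_def algebra_simps)
    moreover have "f H \<le> f G'" using G' by (intro max) (auto simp: H_def)
    ultimately show False by simp
  qed
  moreover have "real (card G) \<le> real (card G') + D * real (card (shadow G))"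
  proof -
    have "0 \<le> D * real (card (shadow G'))" using D by simp
    then show ?thesis using max[of G] by (simp add: f_def)
  qed
  ultimately show ?thesis using G' by blast
qed

lemma card_shadow_le:
  assumes "\<And>e. e \<in> G \<Longrightarrow> e \<subseteq> {1..n::nat} \<and> card e = r"
  shows "card (shadow G) \<le> n ^ (r - 1)"
proof -
  have "shadow G \<subseteq> {B. B \<subseteq> {1..n} \<and> card B = r - 1}"
  proof
    fix B assume "B \<in> shadow G"
    then obtain e x where e: "B = e - {x}" "e \<in> G" "x \<in> e" by (auto simp: shadow_def)
    then have "finite e" using assms[OF e(2)] finite_subset by blast
    then show "B \<in> {B. B \<subseteq> {1..n} \<and> card B = r - 1}"
      using assms[OF e(2)] e card_Diff_singleton[of x e] by auto
  qed
  then have "card (shadow G) \<le> card {B. B \<subseteq> {1..n} \<and> card B = r - 1}"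
    by (intro card_mono) auto
  also have "\<dots> = n choose (r - 1)" by (simp add: n_subsets)
  also have "\<dots> \<le> n ^ (r - 1)"
    by (cases "r - 1 \<le> n") (auto simp: binomial_le_pow binomial_eq_0)
  finally show ?thesis .
qed

text \<open>The vertices of \<open>E\<close> outside \<open>P\<close> are traded for those of
  \<open>Q\<close> one at a time, each trade being one gluing step; the intermediate edges stay in
  the pattern.\<close>

lemma stacked_replace:
  assumes "finite Q" "stacked r U \<E> L" "E \<in> \<E>" "P \<subseteq> E" "card Q = card (E - P)" "Q \<inter> U = {}"
  shows "\<exists>\<E>' L'. stacked r (U \<union> Q) \<E>' L' \<and> \<E> \<subseteq> \<E>' \<and> P \<union> Q \<in> \<E>'"
  using assms
proof (induction Q arbitrary: P rule: finite_induct)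
  case empty
  have "finite E" using stacked_props[OF empty(1)] empty(2) finite_subset by metis
  then have "E = P" using empty by auto
  then show ?case using empty by auto
next
  case (insert x Q)
  have finE: "finite E" using stacked_props[OF insert.prems(1)] insert.prems(2) finite_subset by metis
  have "card (E - P) \<noteq> 0" using insert by simp
  then obtain u where u: "u \<in> E" "u \<notin> P" by (metis DiffE card.empty equals0I)
  \<comment> \<open>The induction keeps \<open>u\<close> as well; it is traded for \<open>x\<close>
    last.\<close>
  have "card (E - insert u P) = card Q"
    using insert.prems(4) insert.hyps u finE card_Suc_Diff1[of "E - P" u]
    by (auto simp: Diff_insert[of E u P])
  then obtain \<E>' L' where 1: "stacked r (U \<union> Q) \<E>' L'" "\<E> \<subseteq> \<E>'" "insert u P \<union> Q \<in> \<E>'"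
    using insert.IH[of "insert u P"] insert.prems u by auto
  have uU: "u \<in> U" using stacked_props(2)[OF insert.prems(1,2)] u by auto
  have "x \<notin> U \<union> Q" using insert by auto
  from stacked.step[OF 1(1,3) _ this, of u]
  have "stacked r (insert x (U \<union> Q)) (insert (insert x (insert u P \<union> Q - {u})) \<E>') ((insert u P \<union> Q - {u}) # L')"
    by simp
  moreover have "insert u P \<union> Q - {u} = P \<union> Q" using u uU insert.prems(5) by auto
  ultimately show ?case using 1(2) by (intro exI) auto
qed

text \<open>
  The joints \<open>i (r - 1)\<close> of the cycle span a polygon, triangulated as a fan from \<open>0\<close>; the triangles are
  completed to \<open>r\<close>-sets by common vertices from \<open>k (r - 1)\<close> onwards, outside the cycle.
\<close>

definition fan_edge :: "nat \<Rightarrow> nat \<Rightarrow> nat \<Rightarrow> nat set" where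
  "fan_edge r k i = {0, i * (r - 1), Suc i * (r - 1)} \<union> {k * (r - 1)..<k * (r - 1) + (r - 3)}"

lemma card_fan_edge:
  assumes "3 \<le> r" "1 \<le> i" "Suc i < k"
  shows "card (fan_edge r k i) = r"
proof -
  have m: "0 < r - 1" using assms by simp
  have lt: "0 < i * (r - 1)" "i * (r - 1) < Suc i * (r - 1)" "Suc i * (r - 1) < k * (r - 1)"
    using assms m by (auto simp del: mult_Suc)
  then have "card {0, i * (r - 1), Suc i * (r - 1)} = 3" by (auto simp del: mult_Suc)
  moreover have "{0, i * (r - 1), Suc i * (r - 1)} \<inter> {k * (r - 1)..<k * (r - 1) + (r - 3)} = {}"
    using lt by (auto simp del: mult_Suc)
  ultimately show ?thesis
    unfolding fan_edge_def using assms by (subst card_Un_disjoint) (auto simp del: mult_Suc)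
qed

text \<open>Consecutive triangles of the fan share the joint \<open>0\<close>, one further joint and
  all fillers, so the next one arises by trading the joint \<open>j * (r - 1)\<close> for a new
  one.\<close>

lemma stacked_fan:
  assumes r: "3 \<le> r" and j: "1 \<le> j" "Suc j < k"
  shows "\<exists>\<E> L. stacked r ((\<lambda>i. i * (r - 1)) ` {..Suc j} \<union> {k * (r - 1)..<k * (r - 1) + (r - 3)}) \<E> L \<and>
    (\<forall>i\<in>{1..j}. fan_edge r k i \<in> \<E>)"
  using j
proof (induction j rule: nat_induct_at_least)
  case base
  have eq: "(\<lambda>i. i * (r - 1)) ` {..Suc 1} \<union> {k * (r - 1)..<k * (r - 1) + (r - 3)} = fan_edge r k 1"
    by (auto simp: fan_edge_def atMost_Suc)
  have "stacked r (fan_edge r k 1) {fan_edge r k 1} []"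
    using card_fan_edge[of r 1 k] r base by (intro stacked.base) (auto simp: fan_edge_def)
  then show ?case unfolding eq by (intro exI conjI) auto
next
  case (Suc j)
  let ?m = "r - 1"
  let ?fill = "{k * ?m..<k * ?m + (r - 3)}"
  have m: "0 < ?m" using r by simp
  from Suc obtain \<E> L where 1: "stacked r ((\<lambda>i. i * ?m) ` {..Suc j} \<union> ?fill) \<E> L"
    "\<forall>i\<in>{1..j}. fan_edge r k i \<in> \<E>" by auto
  have lt: "i * ?m < Suc (Suc j) * ?m" if "i \<le> Suc j" for i using that m by (simp del: mult_Suc)
  have ltk: "Suc (Suc j) * ?m < k * ?m" using Suc.prems m by (simp del: mult_Suc)
  have fresh: "Suc (Suc j) * ?m \<notin> (\<lambda>i. i * ?m) ` {..Suc j} \<union> ?fill"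
    using lt ltk by (force simp del: mult_Suc)
  have "fan_edge r k j \<in> \<E>" "j * ?m \<in> fan_edge r k j" using 1 Suc by (auto simp: fan_edge_def)
  from stacked.step[OF 1(1) this fresh]
  have st: "stacked r (insert (Suc (Suc j) * ?m) ((\<lambda>i. i * ?m) ` {..Suc j} \<union> ?fill))
     (insert (insert (Suc (Suc j) * ?m) (fan_edge r k j - {j * ?m})) \<E>) ((fan_edge r k j - {j * ?m}) # L)" .
  have U: "insert (Suc (Suc j) * ?m) ((\<lambda>i. i * ?m) ` {..Suc j} \<union> ?fill) = (\<lambda>i. i * ?m) ` {..Suc (Suc j)} \<union> ?fill"
    by (auto simp: atMost_Suc simp del: mult_Suc)
  have "j * ?m \<noteq> 0" "j * ?m \<noteq> Suc j * ?m" "j * ?m \<notin> ?fill"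
    using lt[of j] ltk m Suc.hyps by (auto simp del: mult_Suc)
  then have E: "insert (Suc (Suc j) * ?m) (fan_edge r k j - {j * ?m}) = fan_edge r k (Suc j)"
    by (auto simp: fan_edge_def simp del: mult_Suc)
  show ?case
    using st 1(2) unfolding U E by (intro exI conjI) (auto simp: le_Suc_eq)
qed

text \<open>The two joints of each cycle edge form a side of the polygon, hence lie in some triangle
  of the fan. Replacing the other \<open>r - 2\<close> vertices of that triangle by the interior of
  the edge produces the edge.\<close>

lemma stacked_linear_cycle:
  assumes r: "3 \<le> r" and k: "3 \<le> k"
  shows "\<exists>U \<E> L. stacked r U \<E> L \<and> {..<k * (r - 1)} \<subseteq> U \<and> linear_cycle_edge r k ` {..<k} \<subseteq> \<E>"
proof -
  define m where "m = r - 1"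
  have m: "2 \<le> m" using r by (simp add: m_def)
  define fill where "fill = {k * m..<k * m + (r - 3)}"
  define U where "U t = (\<lambda>i. i * m) ` {..k - 1} \<union> fill \<union> (\<Union>i<t. {i * m<..<Suc i * m})" for t
  have "\<exists>\<E> L. stacked r (U t) \<E> L \<and> (\<forall>i\<in>{1..k - 2}. fan_edge r k i \<in> \<E>) \<and>
      (\<forall>i<t. linear_cycle_edge r k i \<in> \<E>)" if "t \<le> k" for t
    using that
  proof (induction t)
    case 0
    have "Suc (k - 2) = k - 1" using k by simp
    then show ?case using stacked_fan[OF r, of "k - 2" k] k by (auto simp: U_def fill_def m_def)
  next
    case (Suc t)
    then obtain \<E> L where 1: "stacked r (U t) \<E> L" "\<forall>i\<in>{1..k - 2}. fan_edge r k i \<in> \<E>"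
      "\<forall>i<t. linear_cycle_edge r k i \<in> \<E>" by auto
    define P where "P = {t * m, (Suc t mod k) * m}"
    \<comment> \<open>The triangle containing side \<open>t\<close>: sides \<open>0\<close> and
      \<open>k - 1\<close> both end in the apex \<open>0\<close> and lie in the first and last
      triangle, any other side in the triangle of its own index.\<close>
    define i where "i = (if t = 0 then 1 else if t = k - 1 then k - 2 else t)"
    have i: "1 \<le> i" "i \<le> k - 2" "Suc i < k" using k Suc.prems by (auto simp: i_def)
    have "Suc (k - 2) = k - 1" using k by simp
    then have PE: "P \<subseteq> fan_edge r k i"
      using k Suc.prems by (auto simp: P_def i_def fan_edge_def m_def mod_Suc simp del: mult_Suc)
    define Q where "Q = {t * m<..<Suc t * m}"
    have cQ: "card Q = m - 1" by (simp add: Q_def)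
    have "t \<noteq> Suc t mod k" using k Suc.prems by (auto simp: mod_Suc)
    then have cP: "card P = 2" using m by (auto simp: P_def)
    have c: "card Q = card (fan_edge r k i - P)"
      using cQ cP card_fan_edge[OF r i(1,3)] PE m_def by (subst card_Diff_subset) (auto simp: P_def)
    have "Q \<inter> U t = {}"
    proof -
      have "x \<notin> U t" if x: "x \<in> Q" for x
      proof -
        have xd: "x div m = t" using x m by (intro div_nat_eqI) (auto simp: Q_def mult.commute)
        have x1: "t * m < x" "x < Suc t * m" using x by (auto simp: Q_def)
        have "Suc t * m \<le> k * m" using Suc.prems by (intro mult_le_mono1)
        then have "x \<notin> fill" using x1 unfolding fill_def by (meson atLeastLessThan_iff leD less_le_trans)
        moreover have "x \<noteq> j * m" for j using xd x1(1) m by auto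
        moreover have "x \<notin> {j * m<..<Suc j * m}" if "j < t" for j
        proof -
          have "Suc j * m \<le> t * m" using that by (intro mult_le_mono1) simp
          then show ?thesis using x1 by (meson greaterThanLessThan_iff less_asym less_le_trans)
        qed
        ultimately show ?thesis by (auto simp: U_def simp del: mult_Suc)
      qed
      then show ?thesis by blast
    qed
    from stacked_replace[OF _ 1(1) _ PE c this] 1(2) i obtain \<E>' L' where 2:
      "stacked r (U t \<union> Q) \<E>' L'" "\<E> \<subseteq> \<E>'" "P \<union> Q \<in> \<E>'" by (auto simp: Q_def)
    have "U t \<union> Q = U (Suc t)" by (auto simp: U_def Q_def lessThan_Suc simp del: mult_Suc)
    moreover have "P \<union> Q = linear_cycle_edge r k t"
    proof -
      have "t * m < Suc t * m" using m by simp
      then have "{t * m..<Suc t * m} = insert (t * m) Q" by (auto simp: Q_def simp del: mult_Suc)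
      then show ?thesis
        using linear_cycle_edge_eq[of r k t] r k Suc.prems by (simp add: P_def m_def insert_commute)
    qed
    ultimately show ?case using 1 2 by (intro exI[of _ \<E>'] exI[of _ L']) (auto simp: less_Suc_eq)
  qed
  from this[of k] obtain \<E> L where 1: "stacked r (U k) \<E> L" "\<forall>i<k. linear_cycle_edge r k i \<in> \<E>" by auto
  have "x \<in> U k" if x: "x < k * m" for x
  proof (cases "x = (x div m) * m")
    case True
    have "x div m < k" using x m by (simp add: less_mult_imp_div_less)
    then show ?thesis using True by (auto simp: U_def intro!: image_eqI[of x _ "x div m"])
  next
    case False
    have "x div m < k" using x m by (simp add: less_mult_imp_div_less)
    moreover have "(x div m) * m < x" using False div_times_less_eq_dividend[of x m] by linarith
    moreover have "x < Suc (x div m) * m" using m dividend_less_div_times[of m x] by simp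
    ultimately show ?thesis by (auto simp: U_def simp del: mult_Suc intro!: bexI[of _ "x div m"])
  qed
  then show ?thesis using 1 by (intro exI[of _ "U k"] exI[of _ \<E>] exI[of _ L]) (auto simp: m_def)
qed

text \<open>With \<open>m = r - 1 \<ge> 2\<close>, the disjoint blocks give
  \<open>card J * m\<close> vertices. A proper \<open>J\<close> has an edge whose end joint lies in
  no block, which yields at least \<open>(card J - 1) * m\<close> vertices beyond the first edge.
  The whole cycle lacks this joint and has \<open>(k - 1) * m - 1\<close>, with equality in the
  claim for \<open>r = k = 3\<close>.\<close>

lemma card_Union_linear_cycle_edges:
  assumes r: "3 \<le> r" and k: "3 \<le> k" and J: "J \<subseteq> {..<k}" "J \<noteq> {}"
  shows "3 * (card J - 1) \<le> 2 * (card (\<Union>i\<in>J. linear_cycle_edge r k i) - r)"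
proof -
  define m where "m = r - 1"
  have m: "2 \<le> m" "r = Suc m" using r by (auto simp: m_def)
  define S where "S = (\<Union>i\<in>J. linear_cycle_edge r k i)"
  define B where "B = (\<Union>i\<in>J. {i * m..<Suc i * m})"
  have finJ: "finite J" using J finite_subset by blast
  have memB: "x \<in> B \<longleftrightarrow> x div m \<in> J" for x
    using div_linear_cycle_block[of m x] m by (auto simp: B_def)
  have edge: "linear_cycle_edge r k i = insert ((Suc i mod k) * m) {i * m..<Suc i * m}" if "i \<in> J" for i
    using linear_cycle_edge_eq[of r k i] that J r k by (auto simp: m_def)
  have BS: "B \<subseteq> S" unfolding B_def S_def using edge by auto
  have finS: "finite S" unfolding S_def using finJ edge by auto
  have cB: "card B = card J * m"
  proof -
    have "{i * m..<Suc i * m} \<inter> {j * m..<Suc j * m} = {}" if "i \<noteq> j" for i j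
      unfolding disjoint_iff using div_linear_cycle_block[of m] m that by (metis not_numeral_le_zero gr0I)
    then have "card B = (\<Sum>i\<in>J. card {i * m..<Suc i * m})"
      unfolding B_def using finJ by (intro card_UN_disjoint) auto
    then show ?thesis by simp
  qed
  have j0: "1 \<le> card J" using J finJ by (simp add: Suc_le_eq card_gt_0_iff)
  show ?thesis
  proof (cases "J = {..<k}")
    case True
    have "k * m \<le> card S" using card_mono[OF finS BS] cB True by simp
    moreover obtain k' where k': "k = k' + 3" using k by (metis le_add_diff_inverse2)
    ultimately have "k' * m + 3 * m \<le> card S" by (simp add: algebra_simps)
    moreover have "k' * 2 \<le> k' * m" using m by (intro mult_le_mono2)
    ultimately have "k' * 2 + 2 * m \<le> Suc (card S - r)" using m(2) by linarith
    then have "k' * 2 + 3 \<le> card S - r" using m(1) by linarith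
    then show ?thesis unfolding S_def[symmetric] using True k' by simp
  next
    case False
    \<comment> \<open>Otherwise \<open>J\<close> would be closed under the cyclic successor and thus
      be all of \<open>{..<k}\<close>.\<close>
    have "\<exists>i\<in>J. Suc i mod k \<notin> J"
    proof (rule ccontr)
      assume closed: "\<not> (\<exists>i\<in>J. Suc i mod k \<notin> J)"
      obtain i0 where i0: "i0 \<in> J" using J by auto
      have cl: "(i0 + n) mod k \<in> J" for n
      proof (induction n)
        case 0
        then show ?case using i0 J by auto
      next
        case (Suc n)
        then have "Suc ((i0 + n) mod k) mod k \<in> J" using closed by blast
        then show ?case by (simp add: mod_Suc_eq)
      qed
      have "x \<in> J" if "x < k" for x
      proof -
        have "i0 < k" using i0 J by auto
        then have "(i0 + (k - i0 + x)) mod k = x" using that by simp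
        then show ?thesis using cl by metis
      qed
      then show False using False J by auto
    qed
    then obtain i where i: "i \<in> J" "Suc i mod k \<notin> J" by blast
    have "(Suc i mod k) * m \<notin> B" unfolding memB using i m by simp
    moreover have "(Suc i mod k) * m \<in> S" unfolding S_def using i edge by auto
    ultimately have "Suc (card B) \<le> card S"
      using card_mono[OF finS, of "insert ((Suc i mod k) * m) B"] BS finite_subset[OF BS finS] by simp
    moreover obtain j' where j': "card J = Suc j'" using j0 by (metis Suc_le_D One_nat_def)
    moreover have "j' * 2 \<le> j' * m" using m by (intro mult_le_mono2)
    moreover have "card B = m + j' * m" using cB j' by simp
    ultimately have "j' * 2 \<le> card S - r" using m(2) by linarith
    then show ?thesis unfolding S_def[symmetric] using j' by simp
  qed
qed

section \<open>Spread weights on linear cycles\<close>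

context full_hypergraph
begin

text \<open>The weight of a \<open>k\<close>-set of edges is the normalised \<open>wt\<close> of all
  injective homomorphisms that send the cycle onto it. In the constant, \<open>2 ^ length L\<close>
  undoes the loss from injectivity, \<open>2 ^ k\<close> counts the positions \<open>J\<close> that
  a given \<open>A\<close> can occupy in the cycle, and \<open>(k * r) ^ (k * r)\<close> the ways of
  mapping the vertices at these positions into \<open>\<Union>A\<close>.\<close>

lemma linear_cycles_spread:
  assumes st: "stacked r U \<E> L" and U: "{..<k * (r - 1)} \<subseteq> U"
    and cyc: "linear_cycle_edge r k ` {..<k} \<subseteq> \<E>"
    and r3: "3 \<le> r" and k3: "3 \<le> k" and D1: "1 \<le> D" "2 * real (card U) \<le> D" and ne: "G \<noteq> {}"
  shows "\<exists>w. spread G w k (2 ^ length L * (2 ^ k * real (k * r) ^ (k * r))) (D powr (- 3 / 2)) \<and>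
    (\<forall>X. 0 < w X \<longrightarrow> (\<exists>\<phi>. inj_on \<phi> U \<and> X = (\<lambda>i. \<phi> ` linear_cycle_edge r k i) ` {..<k}))"
proof -
  define e where "e = linear_cycle_edge r k"
  define Cy where "Cy \<phi> = (\<lambda>i. \<phi> ` e i) ` {..<k}" for \<phi> :: "nat \<Rightarrow> 'a"
  define h where "h \<phi> = (if inj_on \<phi> U then wt G L \<phi> else 0)" for \<phi>
  define c where "c = 2 ^ length L / real (card G)"
  define w where "w X = c * (\<Sum>\<phi>\<in>homs G U \<E>. if Cy \<phi> = X then h \<phi> else 0)" for X
  define p where "p = D powr (- 3 / 2)"
  define M where "M = 2 ^ k * real (k * r) ^ (k * r)"
  have p: "0 < p" using D by (simp add: p_def)
  have cG: "0 < real (card G)" using ne finG by (simp add: card_gt_0_iff)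
  have c0: "0 < c" using cG by (simp add: c_def)
  have h0: "0 \<le> h \<phi>" for \<phi> by (simp add: h_def wt_nonneg)
  have w0: "0 \<le> w X" for X using c0 h0 by (auto simp: w_def intro!: mult_nonneg_nonneg sum_nonneg)
  have finU: "finite U" using stacked_props(1)[OF st] .
  have ei: "e i \<in> \<E>" "e i \<subseteq> U" "card (e i) = r" "finite (e i)" if "i < k" for i
  proof -
    show "e i \<in> \<E>" using cyc that by (auto simp: e_def)
    then show "e i \<subseteq> U" "card (e i) = r" using stacked_props(2)[OF st] by auto
    then show "finite (e i)" using finU finite_subset by auto
  qed
  have e_inj: "inj_on e {..<k}"
    using card_linear_cycle(2)[of r k] r3 k3 unfolding linear_cycle_def e_def
    by (intro eq_card_imp_inj_on) auto
  have CyG: "Cy \<phi> \<subseteq> G" if "\<phi> \<in> homs G U \<E>" for \<phi>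
    using that ei(1) by (auto simp: Cy_def homs_def)
  have Cy_inj: "inj_on (\<lambda>i. \<phi> ` e i) {..<k}" if "inj_on \<phi> U" for \<phi> :: "nat \<Rightarrow> 'a"
  proof (rule inj_onI)
    fix i j assume ij: "i \<in> {..<k}" "j \<in> {..<k}" "\<phi> ` e i = \<phi> ` e j"
    then have "e i = e j" using inj_on_image_eq_iff[OF that, of "e i" "e j"] ei(2) by auto
    then show "i = j" using e_inj ij by (auto simp: inj_on_def)
  qed
  have deg: "wdeg G w A = c * (\<Sum>\<phi>\<in>homs G U \<E>. if A \<subseteq> Cy \<phi> then h \<phi> else 0)" for A
  proof -
    have "wdeg G w A = (\<Sum>X\<in>Pow G. \<Sum>\<phi>\<in>homs G U \<E>. if X = Cy \<phi> then (if A \<subseteq> X then c * h \<phi> else 0) else 0)"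
      unfolding wdeg_indicator[OF finG] w_def sum_distrib_left
    proof (rule sum.cong[OF refl])
      fix X
      show "(if A \<subseteq> X then \<Sum>\<phi>\<in>homs G U \<E>. c * (if Cy \<phi> = X then h \<phi> else 0) else 0) =
          (\<Sum>\<phi>\<in>homs G U \<E>. if X = Cy \<phi> then (if A \<subseteq> X then c * h \<phi> else 0) else 0)"
        by (cases "A \<subseteq> X") (auto intro!: sum.cong sum.neutral)
    qed
    also have "\<dots> = (\<Sum>\<phi>\<in>homs G U \<E>. \<Sum>X\<in>Pow G. if X = Cy \<phi> then (if A \<subseteq> X then c * h \<phi> else 0) else 0)"
      by (rule sum.swap)
    also have "\<dots> = (\<Sum>\<phi>\<in>homs G U \<E>. if A \<subseteq> Cy \<phi> then c * h \<phi> else 0)"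
      using CyG finG by (intro sum.cong refl) (simp add: sum.delta)
    also have "\<dots> = c * (\<Sum>\<phi>\<in>homs G U \<E>. if A \<subseteq> Cy \<phi> then h \<phi> else 0)"
      unfolding sum_distrib_left by (intro sum.cong refl) simp
    finally show ?thesis .
  qed
  have supp: "\<exists>\<phi>. inj_on \<phi> U \<and> X = Cy \<phi>" if "w X \<noteq> 0" for X
  proof -
    have "(\<Sum>\<phi>\<in>homs G U \<E>. if Cy \<phi> = X then h \<phi> else 0) \<noteq> 0" using that by (auto simp: w_def)
    then obtain \<phi> where "(if Cy \<phi> = X then h \<phi> else 0) \<noteq> 0"
      using sum.not_neutral_contains_not_neutral by blast
    then show ?thesis by (intro exI[of _ \<phi>]) (auto simp: h_def split: if_splits)
  qed
  have cCy: "card (Cy \<phi>) = k" if "inj_on \<phi> U" for \<phi>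
    using card_image[OF Cy_inj[OF that]] by (simp add: Cy_def)
  have tot: "1 \<le> wdeg G w {}"
  proof -
    have "c * (real (card G) * (1 / 2) ^ length L) \<le> wdeg G w {}"
      unfolding deg using sum_wt_inj_ge[OF st D1(2)] c0 by (intro mult_left_mono) (auto simp: h_def)
    then show ?thesis using cG by (simp add: c_def power_one_over)
  qed
  have bound: "p * real (card G) * wdeg G w A \<le> 2 ^ length L * M * p ^ card A" if A: "A \<noteq> {}" for A
  proof (cases "\<exists>\<phi>\<in>homs G U \<E>. inj_on \<phi> U \<and> A \<subseteq> Cy \<phi>")
    case False
    then have "wdeg G w A = 0" unfolding deg by (auto simp: h_def intro!: sum.neutral)
    then show ?thesis using p by (simp add: M_def)
  next
    case True
    then obtain \<phi>0 where \<phi>0: "\<phi>0 \<in> homs G U \<E>" "inj_on \<phi>0 U" "A \<subseteq> Cy \<phi>0" by blast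
    have finA: "finite A" using finite_subset[OF \<phi>0(3)] by (simp add: Cy_def)
    have AG: "A \<subseteq> G" using \<phi>0 CyG by blast
    have cA: "card A \<le> k" using card_mono[OF _ \<phi>0(3)] cCy[OF \<phi>0(2)] by (simp add: Cy_def)
    have cA0: "0 < card A" using A finA by (simp add: card_gt_0_iff)
    have cUA: "card (\<Union>A) \<le> k * r"
    proof -
      have "card (\<Union>A) \<le> (\<Sum>a\<in>A. card a)" by (rule card_Union_le_sum_card)
      also have "\<dots> = card A * r" using AG uniform by (simp add: subset_iff)
      finally show ?thesis using cA by (meson le_trans mult_le_mono1)
    qed
    define S where "S J = (\<Union>i\<in>J. e i)" for J
    define \<J> where "\<J> = {J. J \<subseteq> {..<k} \<and> card J = card A}"
    define g where "g J \<sigma> \<phi> = (if \<forall>s\<in>S J. \<phi> s = \<sigma> s then wt G L \<phi> else 0)" for J \<sigma> \<phi>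
    have g0: "0 \<le> g J \<sigma> \<phi>" for J \<sigma> \<phi> by (simp add: g_def wt_nonneg)
    have fin\<J>: "finite \<J>" by (simp add: \<J>_def)
    have finUA: "finite (\<Union>A)" using finA AG finite_edge by blast
    have S: "S J \<subseteq> U" "finite (S J)" "card (S J) \<le> k * r" if "J \<in> \<J>" for J
    proof -
      have J: "J \<subseteq> {..<k}" using that by (simp add: \<J>_def)
      then have "finite J" using finite_subset by blast
      show "S J \<subseteq> U" using J ei(2) by (auto simp: S_def)
      then show "finite (S J)" using finU finite_subset by auto
      have "card (S J) \<le> (\<Sum>i\<in>J. card (e i))" unfolding S_def using \<open>finite J\<close> by (rule card_UN_le)
      also have "\<dots> = card J * r" using J ei(3) by (simp add: subset_iff)
      also have "\<dots> \<le> k * r" using card_mono[OF _ J] by (intro mult_le_mono1) simp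
      finally show "card (S J) \<le> k * r" .
    qed
    have fin\<Sigma>: "finite (S J \<rightarrow>\<^sub>E \<Union>A)" if "J \<in> \<J>" for J using S(2)[OF that] finUA by (intro finite_PiE)
    \<comment> \<open>Union bound: if \<open>A\<close> is part of the cycle of
      \<open>\<phi>\<close>, take for \<open>J\<close> the positions mapped into \<open>A\<close>
      and for \<open>\<sigma>\<close> the restriction of \<open>\<phi>\<close> to their
      vertices.\<close>
    have point: "(if A \<subseteq> Cy \<phi> then h \<phi> else 0) \<le> (\<Sum>J\<in>\<J>. \<Sum>\<sigma>\<in>S J \<rightarrow>\<^sub>E \<Union>A. g J \<sigma> \<phi>)" for \<phi>
    proof (cases "A \<subseteq> Cy \<phi> \<and> inj_on \<phi> U")
      case False
      then have "(if A \<subseteq> Cy \<phi> then h \<phi> else 0) = 0" by (auto simp: h_def)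
      then show ?thesis using g0 by (simp add: sum_nonneg)
    next
      case True
      define J where "J = {i. i < k \<and> \<phi> ` e i \<in> A}"
      have "(\<lambda>i. \<phi> ` e i) ` J = A" using True by (auto simp: J_def Cy_def)
      moreover have "inj_on (\<lambda>i. \<phi> ` e i) J"
        using Cy_inj[of \<phi>] True by (auto simp: J_def intro: inj_on_subset)
      ultimately have "card J = card A" using card_image by metis
      then have J: "J \<in> \<J>" by (auto simp: \<J>_def J_def)
      define \<sigma> where "\<sigma> = restrict \<phi> (S J)"
      have \<sigma>: "\<sigma> \<in> S J \<rightarrow>\<^sub>E \<Union>A" by (auto simp: \<sigma>_def S_def J_def)
      have "h \<phi> = g J \<sigma> \<phi>" using True by (simp add: h_def g_def \<sigma>_def)
      also have "\<dots> \<le> (\<Sum>\<sigma>\<in>S J \<rightarrow>\<^sub>E \<Union>A. g J \<sigma> \<phi>)"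
        using \<sigma> fin\<Sigma>[OF J] g0 by (intro member_le_sum) auto
      also have "\<dots> \<le> (\<Sum>J\<in>\<J>. \<Sum>\<sigma>\<in>S J \<rightarrow>\<^sub>E \<Union>A. g J \<sigma> \<phi>)"
        using J fin\<J> g0 by (intro member_le_sum[of J]) (auto intro: sum_nonneg)
      finally show ?thesis using True by simp
    qed
    have each: "(\<Sum>\<phi>\<in>homs G U \<E>. g J \<sigma> \<phi>) \<le> p ^ (card A - 1)" if J: "J \<in> \<J>" for J \<sigma>
    proof -
      have Jk: "J \<subseteq> {..<k}" "J \<noteq> {}" "card J = card A" using J cA0 by (auto simp: \<J>_def)
      then obtain i where i: "i \<in> J" by blast
      have "(\<Sum>\<phi>\<in>homs G U \<E>. g J \<sigma> \<phi>) \<le> (1 / D) ^ (card (S J) - r)"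
        unfolding g_def using i Jk ei(1) S(1)[OF J]
        by (intro sum_wt_fixed_le[OF st, of _ "e i"]) (auto simp: S_def)
      also have "\<dots> = D powr (- real (card (S J) - r))"
        using D by (simp add: powr_minus powr_realpow power_one_over inverse_eq_divide)
      also have "\<dots> \<le> D powr (- 3 / 2 * real (card A - 1))"
      proof (rule powr_mono)
        have "3 * (card A - 1) \<le> 2 * (card (S J) - r)"
          using card_Union_linear_cycle_edges[OF r3 k3 Jk(1,2)] Jk(3) by (simp add: S_def e_def)
        then have "3 * real (card A - 1) \<le> 2 * real (card (S J) - r)" by linarith
        then show "- real (card (S J) - r) \<le> - 3 / 2 * real (card A - 1)" by simp
      qed (fact D1)
      also have "\<dots> = p ^ (card A - 1)"
        using p by (simp add: p_def powr_powr flip: powr_realpow)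
      finally show ?thesis .
    qed
    have "(\<Sum>\<phi>\<in>homs G U \<E>. if A \<subseteq> Cy \<phi> then h \<phi> else 0)
        \<le> (\<Sum>\<phi>\<in>homs G U \<E>. \<Sum>J\<in>\<J>. \<Sum>\<sigma>\<in>S J \<rightarrow>\<^sub>E \<Union>A. g J \<sigma> \<phi>)"
      by (intro sum_mono point)
    also have "\<dots> = (\<Sum>J\<in>\<J>. \<Sum>\<sigma>\<in>S J \<rightarrow>\<^sub>E \<Union>A. \<Sum>\<phi>\<in>homs G U \<E>. g J \<sigma> \<phi>)"
      by (subst sum.swap) (rule sum.cong[OF refl sum.swap])
    also have "\<dots> \<le> (\<Sum>J\<in>\<J>. \<Sum>\<sigma>\<in>S J \<rightarrow>\<^sub>E \<Union>A. p ^ (card A - 1))"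
      by (intro sum_mono each)
    also have "\<dots> = (\<Sum>J\<in>\<J>. real (card (\<Union>A) ^ card (S J)) * p ^ (card A - 1))"
      using S(2) by (simp add: card_funcsetE)
    also have "\<dots> \<le> (\<Sum>J\<in>\<J>. real (k * r) ^ (k * r) * p ^ (card A - 1))"
    proof (intro sum_mono mult_right_mono)
      fix J assume J: "J \<in> \<J>"
      have "card (\<Union>A) ^ card (S J) \<le> (k * r) ^ card (S J)" using cUA by (intro power_mono) auto
      also have "\<dots> \<le> (k * r) ^ (k * r)" using S(3)[OF J] r3 k3 by (intro power_increasing) auto
      finally have "real (card (\<Union>A) ^ card (S J)) \<le> real ((k * r) ^ (k * r))" by (simp only: of_nat_le_iff)
      then show "real (card (\<Union>A) ^ card (S J)) \<le> real (k * r) ^ (k * r)" by simp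
    qed (use p in auto)
    also have "\<dots> = real (card \<J>) * (real (k * r) ^ (k * r) * p ^ (card A - 1))" by simp
    also have "\<dots> \<le> 2 ^ k * (real (k * r) ^ (k * r) * p ^ (card A - 1))"
    proof (rule mult_right_mono)
      have "card \<J> \<le> card (Pow {..<k})" by (intro card_mono) (auto simp: \<J>_def)
      then have "real (card \<J>) \<le> real (2 ^ k)" by (simp add: card_Pow)
      then show "real (card \<J>) \<le> 2 ^ k" by simp
    qed (use p in auto)
    finally have "(\<Sum>\<phi>\<in>homs G U \<E>. if A \<subseteq> Cy \<phi> then h \<phi> else 0) \<le> M * p ^ (card A - 1)"
      by (simp add: M_def)
    then have "p * real (card G) * wdeg G w A \<le> p * real (card G) * (c * (M * p ^ (card A - 1)))"
      unfolding deg using p c0 by (intro mult_left_mono) auto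
    also have "\<dots> = 2 ^ length L * M * (p * p ^ (card A - 1))" using cG by (simp add: c_def)
    also have "p * p ^ (card A - 1) = p ^ card A" using cA0 by (simp flip: power_Suc)
    finally show ?thesis .
  qed
  have "spread G w k (2 ^ length L * M) p"
    unfolding spread_def using w0 tot bound supp cCy by blast
  moreover have "\<exists>\<phi>. inj_on \<phi> U \<and> X = (\<lambda>i. \<phi> ` linear_cycle_edge r k i) ` {..<k}" if "0 < w X" for X
    using supp[of X] that by (auto simp: Cy_def e_def)
  ultimately show ?thesis unfolding M_def p_def by blast
qed

end

section \<open>Counting\<close>

lemma contains_linear_cycle:
  assumes r: "2 \<le> r" and k: "3 \<le> k" and inj: "inj_on \<phi> {..<k * (r - 1)}"
    and edges: "(\<lambda>i. \<phi> ` linear_cycle_edge r k i) ` {..<k} \<subseteq> I" and I: "\<And>e. e \<in> I \<Longrightarrow> e \<subseteq> V"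
  shows "contains_copy (V, I) (linear_cycle r k)"
proof -
  have "\<phi> x \<in> V" if "x < k * (r - 1)" for x
  proof -
    have m: "0 < r - 1" using r by simp
    have i: "x div (r - 1) < k" using that by (simp add: less_mult_imp_div_less)
    have "x \<in> linear_cycle_edge r k (x div (r - 1))"
      using linear_cycle_edge_eq[OF r k i] div_linear_cycle_block[OF m, of x "x div (r - 1)"] by blast
    moreover have "\<phi> ` linear_cycle_edge r k (x div (r - 1)) \<subseteq> V" using edges I i by blast
    ultimately show ?thesis by blast
  qed
  then show ?thesis
    unfolding contains_copy_def subhypergraph_def linear_cycle_def using inj edges
    by (intro exI[of _ \<phi>]) (auto simp: image_image)
qed

text \<open>By \<open>g \<le> 2 * D * N\<close>, \<open>p * g\<close> is at most
  \<open>2 * N * D powr (- 1 / 2)\<close>, and \<open>1 + 3 * ln D \<le> 13 * D powr (1 / 4)\<close>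
  absorbs the logarithm. This gives 26, doubled when \<open>D\<close> is replaced by
  \<open>2 * D\<close>, the edge density in the application.\<close>

lemma container_count_le:
  fixes D p N :: real and g q k :: nat
  assumes D: "1 \<le> D" and p: "p = D powr (- 3 / 2)" and g: "real g \<le> 2 * D * N"
    and q: "real q \<le> 2 * (p * real g)"
  shows "((1 + p) ^ g * (1 / p) ^ q) ^ k \<le> exp (52 * real k * N * (2 * D) powr (- 1 / 4))"
proof -
  have p0: "0 < p" using D by (simp add: p)
  have lnD: "0 \<le> ln D" using D by simp
  have "(1 + p) ^ g \<le> exp p ^ g" using p0 by (intro power_mono exp_ge_add_one_self) auto
  also have "\<dots> = exp (p * real g)" by (simp add: exp_of_nat_mult[symmetric] mult.commute)
  finally have 1: "(1 + p) ^ g \<le> exp (p * real g)" .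
  have "1 / p = exp (3 / 2 * ln D)" using D by (simp add: p powr_def exp_minus field_simps)
  then have "(1 / p) ^ q = exp (real q * (3 / 2 * ln D))" by (simp only: exp_of_nat_mult[symmetric])
  also have "\<dots> \<le> exp (2 * (p * real g) * (3 / 2 * ln D))"
    using mult_right_mono[OF q, of "3 / 2 * ln D"] lnD by simp
  finally have "(1 + p) ^ g * (1 / p) ^ q \<le> exp (p * real g) * exp (2 * (p * real g) * (3 / 2 * ln D))"
    using 1 p0 by (intro mult_mono) auto
  also have "\<dots> = exp (p * real g * (1 + 3 * ln D))" by (simp add: exp_add[symmetric] algebra_simps)
  also have "\<dots> \<le> exp (52 * N * (2 * D) powr (- 1 / 4))"
  proof -
    have "0 \<le> 2 * D * N" using g by linarith
    then have N: "0 \<le> N" using D by (simp add: zero_le_mult_iff)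
    have "ln D \<le> D powr (1 / 4) / (1 / 4)" using D by (intro ln_powr_bound) auto
    moreover have "1 \<le> D powr (1 / 4)" using D by (intro ge_one_powr_ge_zero) auto
    ultimately have l: "1 + 3 * ln D \<le> 13 * D powr (1 / 4)" by simp
    have "p * real g * (1 + 3 * ln D) \<le> p * (2 * D * N) * (13 * D powr (1 / 4))"
      using l g p0 lnD N D by (intro mult_mono mult_left_mono) auto
    also have "\<dots> = 26 * N * (D powr (- 3 / 2) * D powr 1 * D powr (1 / 4))"
      using D by (simp add: p)
    also have "D powr (- 3 / 2) * D powr 1 * D powr (1 / 4) = D powr (- 1 / 4)"
      by (simp only: powr_add[symmetric]) simp
    also have "26 * N * D powr (- 1 / 4) \<le> 26 * N * (2 * (2 * D) powr (- 1 / 4))"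
    proof (intro mult_left_mono)
      have "(2 * D) powr (- 1 / 4) = 2 powr (- 1 / 4) * D powr (- 1 / 4)" using D by (simp add: powr_mult)
      moreover have "2 powr (- 1) \<le> (2 :: real) powr (- 1 / 4)" by (intro powr_mono) auto
      then have "1 \<le> 2 * (2 :: real) powr (- 1 / 4)" by (simp add: powr_minus)
      then have "1 * D powr (- 1 / 4) \<le> 2 * 2 powr (- 1 / 4) * D powr (- 1 / 4)"
        by (intro mult_right_mono) auto
      ultimately show "D powr (- 1 / 4) \<le> 2 * (2 * D) powr (- 1 / 4)" by simp
    qed (use N in auto)
    finally show ?thesis by (simp add: algebra_simps)
  qed
  finally have "(1 + p) ^ g * (1 / p) ^ q \<le> exp (52 * N * (2 * D) powr (- 1 / 4))" .
  then have "((1 + p) ^ g * (1 / p) ^ q) ^ k \<le> exp (52 * N * (2 * D) powr (- 1 / 4)) ^ k"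
    using p0 by (intro power_mono) auto
  also have "\<dots> = exp (52 * real k * N * (2 * D) powr (- 1 / 4))"
    by (simp add: exp_of_nat_mult[symmetric] algebra_simps)
  finally show ?thesis .
qed

text \<open>Containers are built for the full subgraph \<open>G'\<close> and the discarded edges are
  added back to each of them. As \<open>G'\<close> has at least half of the edges, a shrinkage
  \<open>\<delta>'\<close> within \<open>G'\<close> is still \<open>\<delta>' / 2\<close> within
  \<open>G\<close>.\<close>

lemma linear_cycle_containers:
  assumes r: "3 \<le> r" and k: "3 \<le> k"
  shows "\<exists>C0 \<delta>. 1 \<le> C0 \<and> 0 < \<delta> \<and> \<delta> < 1 \<and> (\<forall>n G. 0 < n \<longrightarrow> G \<subseteq> {e. e \<subseteq> {1..n} \<and> card e = r} \<longrightarrow>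
     C0 * real n ^ (r - 1) \<le> real (card G) \<longrightarrow>
     (\<exists>\<C>. finite \<C> \<and>
        real (card \<C>) \<le> exp (52 * real k * real n ^ (r - 1) * (real (card G) / real n ^ (r - 1)) powr (- 1 / 4)) \<and>
        (\<forall>C\<in>\<C>. C \<subseteq> G \<and> real (card C) \<le> (1 - \<delta>) * real (card G)) \<and>
        (\<forall>I\<subseteq>G. \<not> contains_copy ({1..n}, I) (linear_cycle r k) \<longrightarrow> (\<exists>C\<in>\<C>. I \<subseteq> C))))"
proof -
  obtain U \<E> L where st: "stacked r U \<E> L" and U: "{..<k * (r - 1)} \<subseteq> U"
    and cyc: "linear_cycle_edge r k ` {..<k} \<subseteq> \<E>"
    using stacked_linear_cycle[OF r k] by blast
  define K where "K = 2 ^ length L * (2 ^ k * real (k * r) ^ (k * r))"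
  have K: "0 < K" using r k by (simp add: K_def)
  have Sk: "Suc (k - 1) = k" using k by simp
  obtain \<delta>' where \<delta>': "0 < \<delta>'" "\<delta>' < 1"
    and cont: "\<And>(V :: nat set set) w p. finite V \<Longrightarrow> spread V w k K p \<Longrightarrow> 0 < p \<Longrightarrow> p \<le> \<delta>' \<Longrightarrow>
     1 \<le> p * real (card V) \<Longrightarrow>
     has_containers V w \<delta>' (((1 + p) ^ card V * (1 / p) ^ nat \<lceil>p * real (card V)\<rceil>) ^ (k - 1))"
    using hypergraph_containers[OF K, of "k - 1", where ?'a = "nat set"] unfolding Sk by blast
  \<comment> \<open>The factor 2 compensates \<open>D = t / 2\<close>; the summands ensure
    \<open>1 \<le> D\<close>, \<open>2 * card U \<le> D\<close> and
    \<open>p \<le> 1 / D \<le> \<delta>'\<close>.\<close>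
  define C0 where "C0 = 2 * (1 + 2 * real (card U) + 1 / \<delta>')"
  show ?thesis
  proof (rule exI[of _ C0], rule exI[of _ "\<delta>' / 2"], intro conjI allI impI)
    show "1 \<le> C0" using \<delta>' by (simp add: C0_def add_nonneg_nonneg algebra_simps)
    show "0 < \<delta>' / 2" "\<delta>' / 2 < 1" using \<delta>' by auto
    fix n :: nat and G :: "nat set set"
    assume n: "0 < n" and G: "G \<subseteq> {e. e \<subseteq> {1..n} \<and> card e = r}"
      and big: "C0 * real n ^ (r - 1) \<le> real (card G)"
    define N where "N = real n ^ (r - 1)"
    have N0: "0 < N" using n by (simp add: N_def)
    have finG: "finite G" using G by (rule finite_subset) simp
    define t where "t = real (card G) / N"
    have cG: "real (card G) = t * N" using N0 by (simp add: t_def)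
    define D where "D = t / 2"
    have "C0 \<le> t" using big N0 by (simp add: t_def N_def field_simps)
    then have "1 + 2 * real (card U) + 1 / \<delta>' \<le> D" by (simp add: D_def C0_def)
    moreover have "0 \<le> 1 / \<delta>'" using \<delta>' by simp
    ultimately have D: "1 \<le> D" "2 * real (card U) \<le> D" "1 / \<delta>' \<le> D" by linarith+
    obtain G' where G': "G' \<subseteq> G" "\<forall>e\<in>G'. \<forall>x\<in>e. D \<le> real (card (ext G' (e - {x})))"
      "real (card G) \<le> real (card G') + D * real (card (shadow G))"
      using exists_full_subgraph[OF finG, of r D] G r D(1) by auto
    have finG': "finite G'" using G'(1) finG finite_subset by auto
    have "card (shadow G) \<le> n ^ (r - 1)" using G by (intro card_shadow_le) auto
    then have "real (card (shadow G)) \<le> N" unfolding N_def by (simp flip: of_nat_power)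
    then have "D * real (card (shadow G)) \<le> D * N" using D by (intro mult_left_mono) auto
    then have g_ge: "D * N \<le> real (card G')" using G'(3) cG by (simp add: D_def)
    have g_le: "real (card G') \<le> 2 * D * N" using card_mono[OF finG G'(1)] cG by (simp add: D_def)
    have neG': "G' \<noteq> {}"
    proof
      assume "G' = {}"
      then have "D * N \<le> 0" using g_ge by simp
      then show False using D N0 by (simp add: mult_le_0_iff)
    qed
    interpret H: full_hypergraph G' r D
      using finG' G' G r D by unfold_locales auto
    obtain w where w: "spread G' w k K (D powr (- 3 / 2))"
      "\<And>X. 0 < w X \<Longrightarrow> \<exists>\<phi>. inj_on \<phi> U \<and> X = (\<lambda>i. \<phi> ` linear_cycle_edge r k i) ` {..<k}"
      using H.linear_cycles_spread[OF st U cyc r k D(1,2) neG'] unfolding K_def by blast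
    define p where "p = D powr (- 3 / 2)"
    have p0: "0 < p" using D by (simp add: p_def)
    have "p \<le> D powr (- 1)" unfolding p_def using D by (intro powr_mono) auto
    also have "\<dots> = 1 / D" using D by (simp add: powr_minus inverse_eq_divide)
    also have "\<dots> \<le> \<delta>'" using D \<delta>' by (simp add: field_simps)
    finally have p\<delta>: "p \<le> \<delta>'" .
    \<comment> \<open>Trivially \<open>card G \<le> n ^ r\<close>, so
      \<open>D \<le> n \<le> N\<close>, and \<open>p * D * N\<close> is at least
      \<open>D powr (1 / 2)\<close>.\<close>
    have "1 \<le> p * (D * N)"
    proof -
      have "card G \<le> card {e. e \<subseteq> {1..n} \<and> card e = r}" using G by (intro card_mono) auto
      also have "\<dots> = n choose r" by (simp add: n_subsets)
      also have "\<dots> \<le> n ^ r" by (cases "r \<le> n") (auto simp: binomial_le_pow binomial_eq_0)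
      finally have "real (card G) \<le> real n ^ r" by (simp flip: of_nat_power)
      also have "\<dots> = real n * N" using r by (simp add: N_def flip: power_Suc)
      finally have "t \<le> real n" using cG N0 by simp
      then have Dn: "D \<le> real n" using D(1) by (simp add: D_def)
      have "real n ^ 1 \<le> N" unfolding N_def using n r by (intro power_increasing) auto
      then have DN: "D \<le> N" using Dn by simp
      have "1 = D powr (- 3 / 2) * D powr (3 / 2)" using D by (simp add: powr_add[symmetric])
      also have "\<dots> \<le> D powr (- 3 / 2) * D powr 2" using D by (intro mult_left_mono powr_mono) auto
      also have "D powr 2 = D * D" using D by (simp add: powr_numeral power2_eq_square)
      also have "D powr (- 3 / 2) * (D * D) \<le> D powr (- 3 / 2) * (D * N)"
        using DN D by (intro mult_left_mono) auto
      finally show ?thesis by (simp add: p_def)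
    qed
    also have "\<dots> \<le> p * real (card G')" using g_ge p0 by (intro mult_left_mono) auto
    finally have pg: "1 \<le> p * real (card G')" .
    define B where "B = ((1 + p) ^ card G' * (1 / p) ^ nat \<lceil>p * real (card G')\<rceil>) ^ (k - 1)"
    have "has_containers G' w \<delta>' B" unfolding B_def
      using cont[OF finG' w(1)[folded p_def] p0 p\<delta> pg] .
    then obtain \<C> where \<C>: "finite \<C>" "real (card \<C>) \<le> B"
       "\<forall>C\<in>\<C>. C \<subseteq> G' \<and> real (card C) \<le> (1 - \<delta>') * real (card G')"
       "\<forall>I\<subseteq>G'. windep G' w I \<longrightarrow> (\<exists>C\<in>\<C>. I \<subseteq> C)"
      unfolding has_containers_def by blast
    have "B \<le> exp (52 * real (k - 1) * N * (2 * D) powr (- 1 / 4))"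
      unfolding B_def
    proof (rule container_count_le[OF D(1) p_def g_le])
      show "real (nat \<lceil>p * real (card G')\<rceil>) \<le> 2 * (p * real (card G'))" using pg by linarith
    qed
    also have "\<dots> \<le> exp (52 * real k * N * (2 * D) powr (- 1 / 4))"
      using N0 by (simp add: mult_right_mono)
    finally have B: "B \<le> exp (52 * real k * N * t powr (- 1 / 4))" by (simp add: D_def)
    show "\<exists>\<C>. finite \<C> \<and>
        real (card \<C>) \<le> exp (52 * real k * real n ^ (r - 1) * (real (card G) / real n ^ (r - 1)) powr (- 1 / 4)) \<and>
        (\<forall>C\<in>\<C>. C \<subseteq> G \<and> real (card C) \<le> (1 - \<delta>' / 2) * real (card G)) \<and>
        (\<forall>I\<subseteq>G. \<not> contains_copy ({1..n}, I) (linear_cycle r k) \<longrightarrow> (\<exists>C\<in>\<C>. I \<subseteq> C))"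
    proof (intro exI[of _ "(\<lambda>C. C \<union> (G - G')) ` \<C>"] conjI ballI allI impI)
      show "finite ((\<lambda>C. C \<union> (G - G')) ` \<C>)" using \<C> by simp
      have "real (card ((\<lambda>C. C \<union> (G - G')) ` \<C>)) \<le> real (card \<C>)" using card_image_le[OF \<C>(1)] by simp
      then show "real (card ((\<lambda>C. C \<union> (G - G')) ` \<C>)) \<le>
          exp (52 * real k * real n ^ (r - 1) * (real (card G) / real n ^ (r - 1)) powr (- 1 / 4))"
        using \<C>(2) B by (simp add: N_def t_def)
    next
      fix C' assume "C' \<in> (\<lambda>C. C \<union> (G - G')) ` \<C>"
      then obtain C where C: "C \<in> \<C>" "C' = C \<union> (G - G')" by blast
      show "C' \<subseteq> G" using C \<C>(3) G'(1) by blast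
      have "card C' \<le> card C + card (G - G')" unfolding C(2) by (rule card_Un_le)
      moreover have "real (card (G - G')) = real (card G) - real (card G')"
        using card_mono[OF finG G'(1)] by (simp add: card_Diff_subset[OF finG' G'(1)] of_nat_diff)
      ultimately have "real (card C') \<le> real (card C) + (real (card G) - real (card G'))" by linarith
      also have "\<dots> \<le> real (card G) - \<delta>' * real (card G')"
        using \<C>(3) C(1) by (auto simp: algebra_simps)
      also have "\<dots> \<le> real (card G) - \<delta>' * (real (card G) / 2)"
        using g_ge \<delta>' cG by (simp add: D_def)
      finally show "real (card C') \<le> (1 - \<delta>' / 2) * real (card G)" by (simp add: algebra_simps)
    next
      fix I assume I: "I \<subseteq> G" "\<not> contains_copy ({1..n}, I) (linear_cycle r k)"
      have "windep G' w (I \<inter> G')" unfolding windep_def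
      proof (intro allI impI notI)
        fix X assume X: "X \<subseteq> G'" "0 < w X" "X \<subseteq> I \<inter> G'"
        then obtain \<phi> where \<phi>: "inj_on \<phi> U" "X = (\<lambda>i. \<phi> ` linear_cycle_edge r k i) ` {..<k}"
          using w(2) by blast
        have "contains_copy ({1..n}, I) (linear_cycle r k)"
          using r k inj_on_subset[OF \<phi>(1) U] X(3) \<phi>(2) I(1) G
          by (intro contains_linear_cycle[of r k \<phi>]) auto
        then show False using I(2) by contradiction
      qed
      then obtain C where C: "C \<in> \<C>" "I \<inter> G' \<subseteq> C" using \<C>(4) by blast
      have "I \<subseteq> C \<union> (G - G')" using C(2) I(1) by blast
      then show "\<exists>C\<in>(\<lambda>C. C \<union> (G - G')) ` \<C>. I \<subseteq> C" by (rule bexI) (rule imageI[OF C(1)])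
    qed
  qed
qed

text \<open>Strong induction on \<open>card G\<close> with a bound increasing in the density
  replaces the explicit geometric series. Below density \<open>C0\<close> all subsets are
  counted.\<close>

lemma card_linear_cycle_free_le:
  assumes r: "3 \<le> r" and k: "3 \<le> k"
  shows "\<exists>C>0. \<forall>n>0. real (card {I. I \<subseteq> {e. e \<subseteq> {1..n} \<and> card e = r} \<and>
     \<not> contains_copy ({1..n}, I) (linear_cycle r k)}) \<le> exp (C * real n ^ (r - 1))"
proof -
  obtain C0 \<delta> where C0: "1 \<le> C0" and \<delta>: "0 < \<delta>" "\<delta> < 1"
    and cont: "\<forall>n G. 0 < n \<longrightarrow> G \<subseteq> {e. e \<subseteq> {1..n} \<and> card e = r} \<longrightarrow>
     C0 * real n ^ (r - 1) \<le> real (card G) \<longrightarrow>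
     (\<exists>\<C>. finite \<C> \<and>
        real (card \<C>) \<le> exp (52 * real k * real n ^ (r - 1) * (real (card G) / real n ^ (r - 1)) powr (- 1 / 4)) \<and>
        (\<forall>C\<in>\<C>. C \<subseteq> G \<and> real (card C) \<le> (1 - \<delta>) * real (card G)) \<and>
        (\<forall>I\<subseteq>G. \<not> contains_copy ({1..n}, I) (linear_cycle r k) \<longrightarrow> (\<exists>C\<in>\<C>. I \<subseteq> C)))"
    using linear_cycle_containers[OF r k] by (elim exE conjE) (rule that)
  define K1 where "K1 = 52 * real k"
  define a where "a = (1 - \<delta>) powr (- 1 / 4)"
  have a: "1 < a" unfolding a_def using \<delta> powr_less_mono2_neg[of "- 1 / 4" "1 - \<delta>" 1] by simp
  have K1: "0 < K1" using k by (simp add: K1_def)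
  \<comment> \<open>Chosen so that passing from \<open>t\<close> to \<open>(1 - \<delta>) t\<close> lowers \<open>- C2 t\<^sup>-\<^sup>1\<^sup>/\<^sup>4\<close> by the cost \<open>K1 t\<^sup>-\<^sup>1\<^sup>/\<^sup>4\<close> of one step.\<close>
  define C2 where "C2 = K1 / (a - 1)"
  have C2: "0 < C2" "K1 + C2 = C2 * a" using a K1 by (auto simp: C2_def field_simps)
  have "real (card {I. I \<subseteq> G \<and> \<not> contains_copy ({1..n}, I) (linear_cycle r k)})
      \<le> exp (real n ^ (r - 1) * (C0 + C2 + K1 - C2 * (real (card G) / real n ^ (r - 1)) powr (- 1 / 4)))"
    if n: "0 < n" and "G \<subseteq> {e. e \<subseteq> {1..n} \<and> card e = r}" "C0 * real n ^ (r - 1) \<le> real (card G)" for n G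
    using that(2,3)
  proof (induction "card G" arbitrary: G rule: less_induct)
    case less
    define N where "N = real n ^ (r - 1)"
    have N0: "0 < N" using n by (simp add: N_def)
    define f where "f G = {I. I \<subseteq> G \<and> \<not> contains_copy ({1..n}, I) (linear_cycle r k)}" for G
    define t where "t = real (card G) / N"
    have finG: "finite G" using less.prems(1) by (rule finite_subset) simp
    have t: "C0 \<le> t" using less.prems(2) N0 by (simp add: t_def N_def field_simps)
    have t1: "t powr (- 1 / 4) \<le> 1"
      using powr_mono2'[of "- 1 / 4" 1 t] t C0 by simp
    obtain \<C> where \<C>: "finite \<C>" "real (card \<C>) \<le> exp (K1 * N * t powr (- 1 / 4))"
        "\<forall>C\<in>\<C>. C \<subseteq> G \<and> real (card C) \<le> (1 - \<delta>) * real (card G)"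
        "\<forall>I\<subseteq>G. \<not> contains_copy ({1..n}, I) (linear_cycle r k) \<longrightarrow> (\<exists>C\<in>\<C>. I \<subseteq> C)"
      using cont[rule_format, OF n less.prems, folded N_def K1_def, folded t_def]
      by (elim exE conjE) (rule that)
    \<comment> \<open>The extra \<open>K1 * t powr (- 1 / 4)\<close> is the logarithm of the bound
      on the number of containers, so summing over \<open>\<C>\<close> restores the claim for
      \<open>G\<close>.\<close>
    have each: "real (card (f C)) \<le> exp (N * (C0 + C2 + K1 - C2 * t powr (- 1 / 4) - K1 * t powr (- 1 / 4)))"
      if C: "C \<in> \<C>" for C
    proof (cases "C0 * N \<le> real (card C)")
      case True
      have CG: "C \<subseteq> G" "real (card C) \<le> (1 - \<delta>) * real (card G)" using \<C>(3) C by auto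
      have G0: "0 < real (card G)" 
        using less.prems(2)[folded N_def] mult_pos_pos[of C0 N] C0 N0 by linarith
      have "real (card C) < real (card G)"
        using CG(2) \<delta> G0 by (smt (verit) mult_less_cancel_right2)
      then have "real (card (f C)) \<le> exp (N * (C0 + C2 + K1 - C2 * (real (card C) / N) powr (- 1 / 4)))"
        unfolding f_def N_def using less.prems(1) CG True by (intro less.hyps) (auto simp: N_def)
      also have "\<dots> \<le> exp (N * (C0 + C2 + K1 - C2 * (a * t powr (- 1 / 4))))"
      proof -
        have "0 < real (card C) / N" using True C0 N0 by (smt (verit) divide_pos_pos mult_pos_pos)
        moreover have "real (card C) / N \<le> (1 - \<delta>) * t" using CG(2) N0 by (simp add: t_def field_simps)
        ultimately have "((1 - \<delta>) * t) powr (- 1 / 4) \<le> (real (card C) / N) powr (- 1 / 4)"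
          by (intro powr_mono2') auto
        moreover have "((1 - \<delta>) * t) powr (- 1 / 4) = a * t powr (- 1 / 4)"
          unfolding a_def using \<delta> t C0 by (intro powr_mult) 
        ultimately have "C2 * (a * t powr (- 1 / 4)) \<le> C2 * (real (card C) / N) powr (- 1 / 4)"
          using C2 by (intro mult_left_mono) auto
        then show ?thesis using N0 by simp
      qed
      also have "C2 * (a * t powr (- 1 / 4)) = C2 * t powr (- 1 / 4) + K1 * t powr (- 1 / 4)"
        using C2(2) by (metis distrib_right mult.assoc add.commute)
      finally show ?thesis by (simp add: algebra_simps)
    next
      case False
      \<comment> \<open>Too sparse for the induction hypothesis: \<open>2 ^ card C\<close> suffices,
        and the reserve \<open>C2 + K1\<close> covers both subtracted terms because
        \<open>t powr (- 1 / 4) \<le> 1\<close>.\<close>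
      have finC: "finite C" using \<C>(3) C finG finite_subset by blast
      have "card (f C) \<le> card (Pow C)" using finC by (intro card_mono) (auto simp: f_def)
      then have "real (card (f C)) \<le> 2 ^ card C" using finC by (simp add: card_Pow flip: of_nat_power)
      also have "\<dots> \<le> exp 1 ^ card C" using exp_ge_add_one_self[of 1] by (intro power_mono) auto
      also have "\<dots> = exp (real (card C))" by (simp add: exp_of_nat_mult[symmetric])
      also have "\<dots> \<le> exp (N * C0)" using False by (simp add: mult.commute)
      also have "\<dots> \<le> exp (N * (C0 + C2 + K1 - C2 * t powr (- 1 / 4) - K1 * t powr (- 1 / 4)))"
      proof -
        have "C2 * t powr (- 1 / 4) \<le> C2 * 1" "K1 * t powr (- 1 / 4) \<le> K1 * 1"
          using t1 C2 K1 by (intro mult_left_mono; simp)+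
        then show ?thesis using N0 by simp
      qed
      finally show ?thesis .
    qed
    have finf: "finite (f C)" if "C \<in> \<C>" for C
      using \<C>(3) that finG finite_subset[of C G] by (auto simp: f_def)
    have "f G \<subseteq> (\<Union>C\<in>\<C>. f C)" using \<C>(4) by (auto simp: f_def)
    then have "card (f G) \<le> card (\<Union>C\<in>\<C>. f C)" using \<C>(1) finf by (intro card_mono) auto
    also have "\<dots> \<le> (\<Sum>C\<in>\<C>. card (f C))" using \<C>(1) by (rule card_UN_le)
    finally have "real (card (f G)) \<le> (\<Sum>C\<in>\<C>. real (card (f C)))" by (simp flip: of_nat_sum)
    also have "\<dots> \<le> (\<Sum>C\<in>\<C>. exp (N * (C0 + C2 + K1 - C2 * t powr (- 1 / 4) - K1 * t powr (- 1 / 4))))"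
      by (intro sum_mono each)
    also have "\<dots> = real (card \<C>) * exp (N * (C0 + C2 + K1 - C2 * t powr (- 1 / 4) - K1 * t powr (- 1 / 4)))"
      by simp
    also have "\<dots> \<le> exp (K1 * N * t powr (- 1 / 4)) *
        exp (N * (C0 + C2 + K1 - C2 * t powr (- 1 / 4) - K1 * t powr (- 1 / 4)))"
      using \<C>(2) by (intro mult_right_mono) auto
    also have "\<dots> = exp (N * (C0 + C2 + K1 - C2 * t powr (- 1 / 4)))"
      by (simp add: exp_add[symmetric] algebra_simps)
    finally show ?case by (simp add: f_def N_def t_def)
  qed note main = this
  show ?thesis
  proof (intro exI[of _ "C0 + C2 + K1"] conjI allI impI)
    show "0 < C0 + C2 + K1" using C0 C2 K1 by simp
    fix n :: nat assume n: "0 < n"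
    define N where "N = real n ^ (r - 1)"
    have N0: "0 < N" using n by (simp add: N_def)
    define G where "G = {e. e \<subseteq> {1..n} \<and> card e = r}"
    have finG: "finite G" by (simp add: G_def)
    let ?f = "{I. I \<subseteq> G \<and> \<not> contains_copy ({1..n}, I) (linear_cycle r k)}"
    have "real (card ?f) \<le> exp ((C0 + C2 + K1) * N)"
    proof (cases "C0 * N \<le> real (card G)")
      case True
      then have "real (card ?f) \<le> exp (N * (C0 + C2 + K1 - C2 * (real (card G) / N) powr (- 1 / 4)))"
        unfolding N_def by (intro main[OF n]) (auto simp: G_def)
      also have "\<dots> \<le> exp ((C0 + C2 + K1) * N)"
        using N0 C2 by (simp add: algebra_simps)
      finally show ?thesis .
    next
      case False
      have "card ?f \<le> card (Pow G)" using finG by (intro card_mono) auto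
      then have "real (card ?f) \<le> 2 ^ card G" using finG by (simp add: card_Pow flip: of_nat_power)
      also have "\<dots> \<le> exp 1 ^ card G" using exp_ge_add_one_self[of 1] by (intro power_mono) auto
      also have "\<dots> = exp (real (card G))" by (simp add: exp_of_nat_mult[symmetric])
      also have "\<dots> \<le> exp ((C0 + C2 + K1) * N)"
      proof -
        have "0 \<le> (C2 + K1) * N" using C2 K1 N0 by simp
        then show ?thesis using False by (simp add: algebra_simps)
      qed
      finally show ?thesis .
    qed
    then show "real (card {I. I \<subseteq> {e. e \<subseteq> {1..n} \<and> card e = r} \<and>
     \<not> contains_copy ({1..n}, I) (linear_cycle r k)}) \<le> exp ((C0 + C2 + K1) * real n ^ (r - 1))"
      by (simp add: N_def G_def)
  qed
qed

theorem theorem1p1: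
  fixes r k :: nat
  assumes "r \<ge> 3" and "k \<ge> 3"
  shows "\<exists>C::real. C > 0 \<and>
    (\<forall>n::nat. real (card (Forb r n (linear_cycle r k))) \<le> 2 powr (C * real n ^ (r - 1)))"
proof -
  obtain C where C: "0 < C" and le: "\<And>n. 0 < n \<Longrightarrow> real (card {I. I \<subseteq> {e. e \<subseteq> {1..n} \<and> card e = r} \<and>
     \<not> contains_copy ({1..n}, I) (linear_cycle r k)}) \<le> exp (C * real n ^ (r - 1))"
    using card_linear_cycle_free_le[OF assms] by blast
  show ?thesis
  proof (intro exI[of _ "C / ln 2"] conjI allI)
    show "0 < C / ln 2" using C by simp
    fix n :: nat
    let ?f = "{I. I \<subseteq> {e. e \<subseteq> {1..n} \<and> card e = r} \<and> \<not> contains_copy ({1..n}, I) (linear_cycle r k)}"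
    have fin: "finite ?f" by (rule finite_subset[of _ "Pow (Pow {1..n})"]) auto
    have "Forb r n (linear_cycle r k) \<subseteq> Pair {1..n} ` ?f"
    proof
      fix G assume "G \<in> Forb r n (linear_cycle r k)"
      then show "G \<in> Pair {1..n} ` ?f"
        by (cases G) (auto simp: Forb_def uniform_hypergraph_def)
    qed
    then have card_le: "card (Forb r n (linear_cycle r k)) \<le> card ?f"
      using fin by (meson card_image_le card_mono finite_imageI le_trans)
    have powr_eq: "2 powr (C / ln 2 * real n ^ (r - 1)) = exp (C * real n ^ (r - 1))"
      by (simp add: powr_def)
    show "real (card (Forb r n (linear_cycle r k))) \<le> 2 powr (C / ln 2 * real n ^ (r - 1))"
    \<comment> \<open>For \<open>n = 0\<close> the bound is \<open>2 powr 0 = 1\<close>, attained by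
      the empty family: there are no edges, as \<open>r > 0\<close>.\<close>
    proof (cases "n = 0")
      case True
      then have "?f \<subseteq> {{}}" using assms by auto
      then have "card ?f \<le> card {{} :: nat set set}" by (intro card_mono) auto
      then have "card (Forb r n (linear_cycle r k)) \<le> 1" using card_le by simp
      moreover have "real n ^ (r - 1) = 0" using True assms by simp
      ultimately show ?thesis by (simp only: mult_zero_right) simp
    next
      case False
      then show ?thesis using le[of n] card_le powr_eq by simp
    qed
  qed
qed

end
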